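(* Let $(M,g,Q)$ be an $n$-dimensional statistical manifold with a recurrent metric, whose cubic form is $$(\nabla g)(Y,Z;X)=\omega(X)g(Y,Z)+\omega(Y)g(Z,X)+\omega(Z)g(X,Y)$$ for all vector fields $X,Y,Z$ on $M$, where $\omega$ is a closed $1$-form on $M$. Then $(M,g,Q)$ is conjugate symmetric if and only if it is conjugate Ricci-symmetric.
   Context: A statistical manifold $(M,g,\nabla)$ is a smooth manifold $M$ with a Riemannian metric $g$ and a torsion-free affine connection $\nabla$ such that the cubic form $Q(X,Y,Z)=(\nabla_X g)(Y,Z)=(\nabla g)(Y,Z;X)$ is symmetric in all of $X,Y,Z$; it is also denoted $(M,g,Q)$. The dual connection $\nabla^{*}$ of $\nabla$ is defined by $X\,g(Y,Z)=g(\nabla_X Y,Z)+g(Y,\nabla^{*}_X Z)$; it is again torsion-free. The statistical manifold is said to have a recurrent metric if there is a $1$-form $\omega$ on $M$ such that $(\nabla g)(Y,Z;X)=\omega(X)g(Y,Z)+\omega(Y)g(Z,X)+\omega(Z)g(X,Y)$ for all vector fields $X,Y,Z$. The curvature tensor field of $\nabla$ is $R(X,Y)Z=\nabla_X\nabla_Y Z-\nabla_Y\nabla_X Z-\nabla_{[X,Y]}Z$, and its Ricci tensor is $Ric(Y,Z)=\mathrm{tr}\{X\mapsto R(X,Y)Z\}$; $R^{*}$ and $Ric^{*}$ are defined in the same way from $\nabla^{*}$. The statistical manifold is conjugate symmetric if $R(X,Y)Z=R^{*}(X,Y)Z$ for all vector fields $X,Y,Z$, and conjugate Ricci-symmetric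 if $Ric(Y,Z)=Ric^{*}(Y,Z)$ for all vector fields $Y,Z$. *)

theory Defs
  imports "HOL-Analysis.Analysis" "HOL-Library.Function_Algebras"
begin

text \<open>
  Functions on the manifold, tangent vectors (which are functionals on functions) and vector
  fields all carry their pointwise vector space structure.
\<close>

instantiation "fun" :: (type, real_vector) real_vector
begin

definition scaleR_fun :: "real \<Rightarrow> ('a \<Rightarrow> 'b) \<Rightarrow> 'a \<Rightarrow> 'b"
  where "scaleR_fun c f = (\<lambda>x. c *\<^sub>R f x)"

instance
  by standard (simp_all add: scaleR_fun_def fun_eq_iff scaleR_add_right scaleR_add_left)

end


section \<open>Smooth manifolds\<close>

primrec k_smooth_on :: "nat \<Rightarrow> 'a::euclidean_space set \<Rightarrow> ('a \<Rightarrow> 'b::real_normed_vector) \<Rightarrow> bool"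
  where
    "k_smooth_on 0 S f \<longleftrightarrow> continuous_on S f"
  | "k_smooth_on (Suc k) S f \<longleftrightarrow>
       (\<forall>x\<in>S. f differentiable (at x)) \<and>
       (\<forall>v. k_smooth_on k S (\<lambda>x. frechet_derivative f (at x) v))"

text \<open>Only meant for open \<open>S\<close>.\<close>

definition smooth_on :: "'a::euclidean_space set \<Rightarrow> ('a \<Rightarrow> 'b::real_normed_vector) \<Rightarrow> bool"
  where "smooth_on S f \<longleftrightarrow> (\<forall>k. k_smooth_on k S f)"

type_synonym ('m, 'n) chart = "'m set \<times> ('m \<Rightarrow> real^'n)"

definition is_chart :: "('m::topological_space, 'n::finite) chart \<Rightarrow> bool"
  where "is_chart = (\<lambda>(U, \<phi>). open U \<and> open (\<phi> ` U) \<and>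
           homeomorphism U (\<phi> ` U) \<phi> (inv_into U \<phi>))"

text \<open>
  The manifold is the whole type \<open>'m\<close> (Hausdorff and second countable by its type classes), and
  its dimension is \<open>CARD('n)\<close>. The atlas need not be maximal.
\<close>

definition smooth_manifold ::
    "('m::{t2_space,second_countable_topology}, 'n::finite) chart set \<Rightarrow> bool"
  where "smooth_manifold A \<longleftrightarrow>
    (\<forall>c\<in>A. is_chart c) \<and> (\<Union>c\<in>A. fst c) = UNIV \<and>
    (\<forall>(U, \<phi>)\<in>A. \<forall>(V, \<psi>)\<in>A. smooth_on (\<phi> ` (U \<inter> V)) (\<psi> \<circ> inv_into U \<phi>))"

definition smooth_functions :: "('m, 'n::finite) chart set \<Rightarrow> ('m \<Rightarrow> real) set"
  where "smooth_functions A = {f. \<forall>(U, \<phi>)\<in>A. smooth_on (\<phi> ` U) (f \<circ> inv_into U \<phi>)}"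


section \<open>Tangent vectors and vector fields\<close>

type_synonym 'm tangent_vector = "('m \<Rightarrow> real) \<Rightarrow> real"
type_synonym 'm field = "'m \<Rightarrow> 'm tangent_vector"

text \<open>
  Tangent vectors at \<open>p\<close> are the derivations at \<open>p\<close> of the algebra of smooth functions. They are
  extended by \<open>0\<close> to non-smooth functions, so that each derivation is represented exactly once.
\<close>

definition tangent_space :: "('m, 'n::finite) chart set \<Rightarrow> 'm \<Rightarrow> 'm tangent_vector set"
  where "tangent_space A p = {v.
    (\<forall>f. f \<notin> smooth_functions A \<longrightarrow> v f = 0) \<and>
    (\<forall>f\<in>smooth_functions A. \<forall>h\<in>smooth_functions A.
       v (f + h) = v f + v h \<and> v (f * h) = f p * v h + h p * v f) \<and>
    (\<forall>f\<in>smooth_functions A. \<forall>c. v (c *\<^sub>R f) = c * v f)}"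

definition app_field :: "'m field \<Rightarrow> ('m \<Rightarrow> real) \<Rightarrow> 'm \<Rightarrow> real"
  where "app_field X f = (\<lambda>p. X p f)"

definition scale_field :: "('m \<Rightarrow> real) \<Rightarrow> 'm field \<Rightarrow> 'm field"
  where "scale_field f X = (\<lambda>p. f p *\<^sub>R X p)"

definition vector_field :: "('m, 'n::finite) chart set \<Rightarrow> 'm field \<Rightarrow> bool"
  where "vector_field A X \<longleftrightarrow>
    (\<forall>p. X p \<in> tangent_space A p) \<and>
    (\<forall>f\<in>smooth_functions A. app_field X f \<in> smooth_functions A)"

definition lie_bracket :: "('m, 'n::finite) chart set \<Rightarrow> 'm field \<Rightarrow> 'm field \<Rightarrow> 'm field"
  where "lie_bracket A X Y = (\<lambda>p f. if f \<in> smooth_functions A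
           then X p (app_field Y f) - Y p (app_field X f) else 0)"


section \<open>One-forms, metrics and connections\<close>

type_synonym 'm form1 = "'m \<Rightarrow> 'm tangent_vector \<Rightarrow> real"
type_synonym 'm form2 = "'m \<Rightarrow> 'm tangent_vector \<Rightarrow> 'm tangent_vector \<Rightarrow> real"
type_synonym 'm connection = "'m field \<Rightarrow> 'm field \<Rightarrow> 'm field"

definition app_form :: "'m form1 \<Rightarrow> 'm field \<Rightarrow> 'm \<Rightarrow> real"
  where "app_form \<omega> X = (\<lambda>p. \<omega> p (X p))"

definition app_metric :: "'m form2 \<Rightarrow> 'm field \<Rightarrow> 'm field \<Rightarrow> 'm \<Rightarrow> real"
  where "app_metric g X Y = (\<lambda>p. g p (X p) (Y p))"

definition one_form :: "('m, 'n::finite) chart set \<Rightarrow> 'm form1 \<Rightarrow> bool"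
  where "one_form A \<omega> \<longleftrightarrow>
    (\<forall>p. \<forall>u\<in>tangent_space A p. \<forall>v\<in>tangent_space A p. \<omega> p (u + v) = \<omega> p u + \<omega> p v) \<and>
    (\<forall>p. \<forall>u\<in>tangent_space A p. \<forall>c. \<omega> p (c *\<^sub>R u) = c * \<omega> p u) \<and>
    (\<forall>X. vector_field A X \<longrightarrow> app_form \<omega> X \<in> smooth_functions A)"

definition exterior_derivative ::
    "('m, 'n::finite) chart set \<Rightarrow> 'm form1 \<Rightarrow> 'm field \<Rightarrow> 'm field \<Rightarrow> 'm \<Rightarrow> real"
  where "exterior_derivative A \<omega> X Y =
    app_field X (app_form \<omega> Y) - app_field Y (app_form \<omega> X) - app_form \<omega> (lie_bracket A X Y)"

definition closed_form :: "('m, 'n::finite) chart set \<Rightarrow> 'm form1 \<Rightarrow> bool"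
  where "closed_form A \<omega> \<longleftrightarrow>
    (\<forall>X Y. vector_field A X \<longrightarrow> vector_field A Y \<longrightarrow> exterior_derivative A \<omega> X Y = 0)"

definition riemannian_metric :: "('m, 'n::finite) chart set \<Rightarrow> 'm form2 \<Rightarrow> bool"
  where "riemannian_metric A g \<longleftrightarrow>
    (\<forall>p. \<forall>u\<in>tangent_space A p. \<forall>v\<in>tangent_space A p. g p u v = g p v u) \<and>
    (\<forall>p. \<forall>u\<in>tangent_space A p. \<forall>v\<in>tangent_space A p. \<forall>w\<in>tangent_space A p.
       g p (u + v) w = g p u w + g p v w) \<and>
    (\<forall>p. \<forall>u\<in>tangent_space A p. \<forall>v\<in>tangent_space A p. \<forall>c. g p (c *\<^sub>R u) v = c * g p u v) \<and>
    (\<forall>p. \<forall>u\<in>tangent_space A p. u \<noteq> 0 \<longrightarrow> g p u u > 0) \<and>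
    (\<forall>X Y. vector_field A X \<longrightarrow> vector_field A Y \<longrightarrow> app_metric g X Y \<in> smooth_functions A)"

definition affine_connection :: "('m, 'n::finite) chart set \<Rightarrow> 'm connection \<Rightarrow> bool"
  where "affine_connection A nabla \<longleftrightarrow>
    (\<forall>X Y. vector_field A X \<longrightarrow> vector_field A Y \<longrightarrow> vector_field A (nabla X Y)) \<and>
    (\<forall>X X' Y. vector_field A X \<longrightarrow> vector_field A X' \<longrightarrow> vector_field A Y \<longrightarrow>
       nabla (X + X') Y = nabla X Y + nabla X' Y) \<and>
    (\<forall>f X Y. f \<in> smooth_functions A \<longrightarrow> vector_field A X \<longrightarrow> vector_field A Y \<longrightarrow>
       nabla (scale_field f X) Y = scale_field f (nabla X Y)) \<and>
    (\<forall>X Y Y'. vector_field A X \<longrightarrow> vector_field A Y \<longrightarrow> vector_field A Y' \<longrightarrow>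
       nabla X (Y + Y') = nabla X Y + nabla X Y') \<and>
    (\<forall>f X Y. f \<in> smooth_functions A \<longrightarrow> vector_field A X \<longrightarrow> vector_field A Y \<longrightarrow>
       nabla X (scale_field f Y) = scale_field (app_field X f) Y + scale_field f (nabla X Y))"

definition torsion_free :: "('m, 'n::finite) chart set \<Rightarrow> 'm connection \<Rightarrow> bool"
  where "torsion_free A nabla \<longleftrightarrow>
    (\<forall>X Y. vector_field A X \<longrightarrow> vector_field A Y \<longrightarrow>
       nabla X Y - nabla Y X = lie_bracket A X Y)"


section \<open>Statistical manifolds\<close>

text \<open>\<open>nabla_metric g nabla Y Z X\<close> is $(\nabla g)(Y,Z;X) = (\nabla_X g)(Y,Z)$.\<close>

definition nabla_metric ::
    "'m form2 \<Rightarrow> 'm connection \<Rightarrow> 'm field \<Rightarrow> 'm field \<Rightarrow> 'm field \<Rightarrow> 'm \<Rightarrow> real"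
  where "nabla_metric g nabla Y Z X =
    app_field X (app_metric g Y Z) - app_metric g (nabla X Y) Z - app_metric g Y (nabla X Z)"

definition cubic_form ::
    "'m form2 \<Rightarrow> 'm connection \<Rightarrow> 'm field \<Rightarrow> 'm field \<Rightarrow> 'm field \<Rightarrow> 'm \<Rightarrow> real"
  where "cubic_form g nabla X Y Z = nabla_metric g nabla Y Z X"

definition statistical_manifold ::
    "('m::{t2_space,second_countable_topology}, 'n::finite) chart set \<Rightarrow>
     'm form2 \<Rightarrow> 'm connection \<Rightarrow> bool"
  where "statistical_manifold A g nabla \<longleftrightarrow>
    smooth_manifold A \<and> riemannian_metric A g \<and>
    affine_connection A nabla \<and> torsion_free A nabla \<and>
    (\<forall>X Y Z. vector_field A X \<longrightarrow> vector_field A Y \<longrightarrow> vector_field A Z \<longrightarrow>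
       cubic_form g nabla X Y Z = cubic_form g nabla Y X Z \<and>
       cubic_form g nabla X Y Z = cubic_form g nabla X Z Y)"

text \<open>
  The field \<open>W\<close> below is $\nabla^{*}_X Z$. It exists and is unique because \<open>g\<close> is
  non-degenerate.
\<close>

definition dual_connection ::
    "('m, 'n::finite) chart set \<Rightarrow> 'm form2 \<Rightarrow> 'm connection \<Rightarrow> 'm connection"
  where "dual_connection A g nabla X Z = (THE W. vector_field A W \<and>
    (\<forall>Y. vector_field A Y \<longrightarrow>
       app_field X (app_metric g Y Z) = app_metric g (nabla X Y) Z + app_metric g Y W))"

definition curvature ::
    "('m, 'n::finite) chart set \<Rightarrow> 'm connection \<Rightarrow> 'm field \<Rightarrow> 'm field \<Rightarrow> 'm field \<Rightarrow> 'm field"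
  where "curvature A nabla X Y Z =
    nabla X (nabla Y Z) - nabla Y (nabla X Z) - nabla (lie_bracket A X Y) Z"

text \<open>
  The trace of an endomorphism \<open>T\<close> of a finite-dimensional subspace \<open>V\<close>: the sum of the diagonal
  entries with respect to some basis of \<open>V\<close>.
\<close>

definition trace_on :: "'v::real_vector set \<Rightarrow> ('v \<Rightarrow> 'v) \<Rightarrow> real"
  where "trace_on V T =
    (let B = (SOME B. independent B \<and> span B = V) in \<Sum>b\<in>B. representation B (T b) b)"

text \<open>
  The linear map on the tangent space at \<open>p\<close> induced by a tensorial (function-linear) map \<open>T\<close> on
  vector fields: extend the tangent vector to a vector field, apply \<open>T\<close> and evaluate at \<open>p\<close>. By
  tensoriality the extension chosen does not matter.
\<close>

definition value_at ::
    "('m, 'n::finite) chart set \<Rightarrow> ('m field \<Rightarrow> 'm field) \<Rightarrow> 'm \<Rightarrow>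
     'm tangent_vector \<Rightarrow> 'm tangent_vector"
  where "value_at A T p v = T (SOME X. vector_field A X \<and> X p = v) p"

definition Ricci ::
    "('m, 'n::finite) chart set \<Rightarrow> 'm connection \<Rightarrow> 'm field \<Rightarrow> 'm field \<Rightarrow> 'm \<Rightarrow> real"
  where "Ricci A nabla Y Z = (\<lambda>p.
    trace_on (tangent_space A p) (value_at A (\<lambda>X. curvature A nabla X Y Z) p))"

definition conjugate_symmetric ::
    "('m, 'n::finite) chart set \<Rightarrow> 'm form2 \<Rightarrow> 'm connection \<Rightarrow> bool"
  where "conjugate_symmetric A g nabla \<longleftrightarrow>
    (\<forall>X Y Z. vector_field A X \<longrightarrow> vector_field A Y \<longrightarrow> vector_field A Z \<longrightarrow>
       curvature A nabla X Y Z = curvature A (dual_connection A g nabla) X Y Z)"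

definition conjugate_Ricci_symmetric ::
    "('m, 'n::finite) chart set \<Rightarrow> 'm form2 \<Rightarrow> 'm connection \<Rightarrow> bool"
  where "conjugate_Ricci_symmetric A g nabla \<longleftrightarrow>
    (\<forall>Y Z. vector_field A Y \<longrightarrow> vector_field A Z \<longrightarrow>
       Ricci A nabla Y Z = Ricci A (dual_connection A g nabla) Y Z)"

end

theory Submission
  imports Defs "HOL-Real_Asymp.Real_Asymp"
begin

text \<open>
  Let \<open>U\<close> be the vector field dual to \<open>\<omega>\<close>. Recurrence of the metric means that
  $\nabla^{*}_X Z = \nabla_X Z + \omega(X) Z + \omega(Z) X + g(X,Z) U$. Put
  $L X = \nabla_X U + \omega(X) U + \omega(U) X$. Since \<open>\<omega>\<close> is closed, $g(L X, Z)$ is symmetric, and a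
  computation gives
  $$R^{*}(X,Y)Z - R(X,Y)Z = g(LX,Z)Y - g(LY,Z)X + g(Y,Z)LX - g(X,Z)LY.$$
  Taking the trace over $X$ yields $Ric^{*}(Y,Z) - Ric(Y,Z) = \mathrm{tr}(L)\,g(Y,Z) - n\,g(LY,Z)$. If this
  vanishes, then \<open>L\<close> is a pointwise multiple of the identity and the right-hand side of the
  curvature formula is zero.

  The existence of a smooth \<open>U\<close>, of extensions of tangent vectors to vector fields, and of finite
  bases of the tangent spaces rests on local frames, which come from bump functions and Hadamard's
  lemma: for smooth \<open>F\<close>, $F(y) - F(a)$ is a combination of the coordinates of $y - a$ with smooth
  coefficients, so that a derivation is determined by its values on coordinate functions.
\<close>

section \<open>Smooth functions on Euclidean spaces\<close>

text \<open>The definitions speak only of global objects: a tangent vector acts on functions smooth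
  on the whole manifold, and a connection takes global fields. Every local construction therefore
  has to be cut off by a bump function; even the fact that a derivation sees only the germ of a
  function needs one. The dual connection, the basis in the trace and the extensions of tangent
  vectors are choice terms; each is replaced by an explicit object, or kept as one fixed choice,
  before anything is computed. Closedness of \<omega> enters twice: the coefficient of Z in R*(X,Y)Z
  - R(X,Y)Z is d\<omega>(X,Y), and g(LX,Y) - g(LY,X) equals d\<omega>(X,Y) as well. In the trace,
  the first and the last term of the curvature formula contract to g(LY,Z) with opposite signs and
  cancel. For L = c id the four terms of the formula cancel in pairs. That equal curvatures give
  equal Ricci tensors holds summand by summand.\<close>

lemma k_smooth_on_cong:
  assumes "open S" "\<And>x. x \<in> S \<Longrightarrow> f x = g x"
  shows "k_smooth_on k S f \<longleftrightarrow> k_smooth_on k S g"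
proof -
  have "k_smooth_on k S g" if "k_smooth_on k S f" "\<And>x. x \<in> S \<Longrightarrow> f x = g x"
    for f g :: "'a \<Rightarrow> 'b"
    using that
  proof (induction k arbitrary: f g)
    case 0
    then show ?case using continuous_on_cong by force
  next
    case (Suc k)
    \<comment> \<open>Since \<open>S\<close> is open, \<open>f\<close> and \<open>g\<close> agree in
      a neighbourhood of \<open>x\<close> and so share the derivative there.\<close>
    have d: "(g has_derivative frechet_derivative f (at x)) (at x)" if "x \<in> S" for x
      using that Suc.prems has_derivative_transform_within_open[OF _ \<open>open S\<close> that]
      by (metis frechet_derivative_works k_smooth_on.simps(2))
    have "k_smooth_on k S (\<lambda>x. frechet_derivative g (at x) v)" for v
    proof (rule Suc.IH)
      show "k_smooth_on k S (\<lambda>x. frechet_derivative f (at x) v)"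
        using Suc.prems(1) by simp
      show "frechet_derivative f (at x) v = frechet_derivative g (at x) v" if "x \<in> S" for x
        using frechet_derivative_at[OF d[OF that]] by simp
    qed
    moreover have "g differentiable (at x)" if "x \<in> S" for x
      using d[OF that] by (rule differentiableI)
    ultimately show ?case by simp
  qed
  from this[of f g] this[of g f] show ?thesis using assms(2) by metis
qed

lemma k_smooth_on_subset:
  "k_smooth_on k S f \<Longrightarrow> T \<subseteq> S \<Longrightarrow> k_smooth_on k T f"
  by (induction k arbitrary: f) (auto intro: continuous_on_subset)

lemma k_smooth_on_continuous: "k_smooth_on k S f \<Longrightarrow> continuous_on S f"
  by (cases k) (auto intro!: continuous_at_imp_continuous_on differentiable_imp_continuous_within)

lemma k_smooth_on_SucD: "k_smooth_on (Suc k) S f \<Longrightarrow> k_smooth_on k S f"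
proof (induction k arbitrary: f)
  case 0
  then show ?case by (metis k_smooth_on.simps(1) k_smooth_on_continuous)
qed auto

text \<open>Smoothness is defined through the choice term \<open>frechet_derivative\<close>; this
  rule accepts any explicit derivative instead. In the closure lemmas that follow, the explicit
  derivative is built from functions of order \<open>k\<close>, so that induction on
  \<open>k\<close> applies.\<close>

lemma k_smooth_on_SucI:
  assumes "open S" "\<And>x. x \<in> S \<Longrightarrow> (f has_derivative f' x) (at x)"
    and "\<And>v. k_smooth_on k S (\<lambda>x. f' x v)"
  shows "k_smooth_on (Suc k) S f"
proof -
  have "frechet_derivative f (at x) v = f' x v" if "x \<in> S" for x v
    using that assms(2) frechet_derivative_at by metis
  then show ?thesis
    using assms k_smooth_on_cong[OF assms(1), of "\<lambda>x. frechet_derivative f (at x) _" "\<lambda>x. f' x _"]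
    by (auto simp: differentiable_def)
qed

lemma k_smooth_on_has_derivative:
  "k_smooth_on (Suc k) S f \<Longrightarrow> x \<in> S \<Longrightarrow> (f has_derivative frechet_derivative f (at x)) (at x)"
  by (simp add: frechet_derivative_works)

lemma k_smooth_on_Union:
  assumes "\<And>x. x \<in> S \<Longrightarrow> \<exists>T. open T \<and> x \<in> T \<and> k_smooth_on k T f"
  shows "k_smooth_on k S f"
  using assms
proof (induction k arbitrary: f)
  case 0
  then show ?case
    by (metis continuous_at_imp_continuous_on continuous_on_eq_continuous_at k_smooth_on.simps(1))
next
  case (Suc k)
  show ?case
    unfolding k_smooth_on.simps
  proof (intro conjI ballI allI)
    show "f differentiable (at x)" if "x \<in> S" for x
      using Suc.prems[OF that] by auto
    show "k_smooth_on k S (\<lambda>x. frechet_derivative f (at x) v)" for v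
    proof (rule Suc.IH)
      show "\<exists>T. open T \<and> x \<in> T \<and> k_smooth_on k T (\<lambda>x. frechet_derivative f (at x) v)"
        if "x \<in> S" for x
        using Suc.prems[OF that] unfolding k_smooth_on.simps by blast
    qed
  qed
qed

lemma k_smooth_on_const: "open S \<Longrightarrow> k_smooth_on k S (\<lambda>x. c)"
proof (induction k arbitrary: c)
  case (Suc k)
  show ?case
    by (rule k_smooth_on_SucI[where f' = "\<lambda>_ _. 0"]) (auto intro: Suc)
qed simp

lemma k_smooth_on_linear:
  assumes "bounded_linear L" "open S" "k_smooth_on k S f"
  shows "k_smooth_on k S (\<lambda>x. L (f x))"
  using assms(3)
proof (induction k arbitrary: f)
  case 0
  then show ?case
    by (auto intro: bounded_linear.continuous_on[OF assms(1)])
next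
  case (Suc k)
  show ?case
    by (rule k_smooth_on_SucI[OF assms(2) bounded_linear.has_derivative[OF assms(1)
          k_smooth_on_has_derivative[OF Suc.prems]]]) (use Suc in auto)
qed

lemma k_smooth_on_id: "open S \<Longrightarrow> k_smooth_on k S (\<lambda>x. x)"
proof (induction k)
  case (Suc k)
  show ?case
    by (rule k_smooth_on_SucI[where f' = "\<lambda>_ v. v"]) (auto intro: Suc k_smooth_on_const)
qed simp

lemma k_smooth_on_add:
  assumes "open S" "k_smooth_on k S f" "k_smooth_on k S g"
  shows "k_smooth_on k S (\<lambda>x. f x + g x)"
  using assms(2,3)
proof (induction k arbitrary: f g)
  case 0
  then show ?case by (auto intro: continuous_intros)
next
  case (Suc k)
  show ?case
    by (rule k_smooth_on_SucI[OF assms(1) has_derivative_add[OF k_smooth_on_has_derivative[OF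
            Suc.prems(1)] k_smooth_on_has_derivative[OF Suc.prems(2)]]]) (use Suc in auto)
qed

lemma k_smooth_on_mult:
  fixes f g :: "'a::euclidean_space \<Rightarrow> real"
  assumes "open S" "k_smooth_on k S f" "k_smooth_on k S g"
  shows "k_smooth_on k S (\<lambda>x. f x * g x)"
  using assms(2,3)
proof (induction k arbitrary: f g)
  case 0
  then show ?case by (auto intro: continuous_intros)
next
  case (Suc k)
  show ?case
  proof (rule k_smooth_on_SucI[OF assms(1)])
    show "((\<lambda>x. f x * g x) has_derivative
        (\<lambda>v. f x * frechet_derivative g (at x) v + frechet_derivative f (at x) v * g x)) (at x)"
      if "x \<in> S" for x
      using that k_smooth_on_has_derivative Suc.prems has_derivative_mult by blast
    show "k_smooth_on k S
        (\<lambda>x. f x * frechet_derivative g (at x) v + frechet_derivative f (at x) v * g x)" for v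
      using Suc.prems by (intro k_smooth_on_add[OF assms(1)] Suc.IH k_smooth_on_SucD[OF Suc.prems(1)]
          k_smooth_on_SucD[OF Suc.prems(2)]) simp_all
  qed
qed

lemma k_smooth_on_sum:
  assumes "open S" "\<And>i. i \<in> I \<Longrightarrow> k_smooth_on k S (f i)"
  shows "k_smooth_on k S (\<lambda>x. \<Sum>i\<in>I. f i x)"
  using assms(2)
proof (induction I rule: infinite_finite_induct)
  case (insert i I)
  then show ?case by (simp add: k_smooth_on_add[OF assms(1)])
qed (simp_all add: k_smooth_on_const[OF assms(1)])

lemma k_smooth_on_inverse:
  fixes f :: "'a::euclidean_space \<Rightarrow> real"
  assumes "open S" "k_smooth_on k S f" "\<And>x. x \<in> S \<Longrightarrow> f x \<noteq> 0"
  shows "k_smooth_on k S (\<lambda>x. inverse (f x))"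
  using assms(2)
proof (induction k)
  case 0
  then show ?case using assms(3) by (auto intro!: continuous_intros)
next
  case (Suc k)
  show ?case
  proof (rule k_smooth_on_SucI[OF assms(1)])
    \<comment> \<open>The derivative involves only the inverse itself and a derivative of
      \<open>f\<close>, so \<open>f\<close> stays fixed in the induction. The sign is a constant
      factor to fit \<open>k_smooth_on_mult\<close>.\<close>
    show "((\<lambda>x. inverse (f x)) has_derivative
        (\<lambda>v. (- 1) * (inverse (f x) * frechet_derivative f (at x) v * inverse (f x)))) (at x)"
      if "x \<in> S" for x
      using Deriv.has_derivative_inverse[OF assms(3)[OF that] k_smooth_on_has_derivative[OF Suc.prems that]]
      by simp
    show "k_smooth_on k S
       (\<lambda>x. (- 1) * (inverse (f x) * frechet_derivative f (at x) v * inverse (f x)))" for v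
      using Suc.IH[OF k_smooth_on_SucD[OF Suc.prems]] Suc.prems
      by (intro k_smooth_on_mult[OF assms(1)] k_smooth_on_const[OF assms(1)]) auto
  qed
qed

text \<open>The chain rule differentiates \<open>f\<close> in a direction that moves with
  \<open>x\<close>, whereas the induction hypothesis handles derivatives in a fixed direction.
  Expanding the moving direction in \<open>Basis\<close> leaves sums of products of a component of
  the derivative of \<open>g\<close> with a fixed-direction derivative of \<open>f\<close> along
  \<open>g\<close>.\<close>

lemma k_smooth_on_compose:
  fixes f :: "'b::euclidean_space \<Rightarrow> real" and g :: "'a::euclidean_space \<Rightarrow> 'b"
  assumes "open S" "open T" "g ` S \<subseteq> T" "k_smooth_on k T f" "k_smooth_on k S g"
  shows "k_smooth_on k S (\<lambda>x. f (g x))"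
  using assms(4,5)
proof (induction k arbitrary: f)
  case 0
  then show ?case using assms(3) continuous_on_compose2 by auto
next
  case (Suc k)
  have lin: "linear (frechet_derivative f (at (g x)))" if "x \<in> S" for x
    using that Suc.prems assms(3) by (auto intro!: linear_frechet_derivative)
  have eq: "frechet_derivative f (at (g x)) w
      = (\<Sum>i\<in>Basis. (w \<bullet> i) * frechet_derivative f (at (g x)) i)" if "x \<in> S" for x w
    by (subst euclidean_representation[of w, symmetric])
      (simp add: linear_sum[OF lin[OF that]] linear_scale[OF lin[OF that]] del: euclidean_representation)
  show ?case
  proof (rule k_smooth_on_SucI[OF assms(1)])
    show "((\<lambda>x. f (g x)) has_derivative (\<lambda>v. \<Sum>i\<in>Basis.
        (frechet_derivative g (at x) v \<bullet> i) * frechet_derivative f (at (g x)) i)) (at x)"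
      if "x \<in> S" for x
    proof -
      have "g x \<in> T" using that assms(3) by auto
      from has_derivative_compose[OF k_smooth_on_has_derivative[OF Suc.prems(2) that]
          k_smooth_on_has_derivative[OF Suc.prems(1) this]]
      show ?thesis by (subst (asm) eq[OF that])
    qed
    show "k_smooth_on k S (\<lambda>x. \<Sum>i\<in>Basis.
        (frechet_derivative g (at x) v \<bullet> i) * frechet_derivative f (at (g x)) i)" for v
    proof (intro k_smooth_on_sum[OF assms(1)] k_smooth_on_mult[OF assms(1)])
      show "k_smooth_on k S (\<lambda>x. frechet_derivative g (at x) v \<bullet> i)" for i
        using Suc.prems(2) by (intro k_smooth_on_linear[OF bounded_linear_inner_left assms(1)]) simp
      show "k_smooth_on k S (\<lambda>x. frechet_derivative f (at (g x)) i)" for i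
        using Suc.prems k_smooth_on_SucD
        by (intro Suc.IH[of "\<lambda>y. frechet_derivative f (at y) i"]) simp_all
    qed
  qed
qed

lemma smooth_on_cong:
  "open S \<Longrightarrow> (\<And>x. x \<in> S \<Longrightarrow> f x = g x) \<Longrightarrow> smooth_on S f \<longleftrightarrow> smooth_on S g"
  unfolding smooth_on_def by (intro all_cong1 k_smooth_on_cong)

lemma smooth_on_subset: "smooth_on S f \<Longrightarrow> T \<subseteq> S \<Longrightarrow> smooth_on T f"
  using k_smooth_on_subset unfolding smooth_on_def by blast

lemma smooth_on_Union:
  assumes "\<And>x. x \<in> S \<Longrightarrow> \<exists>T. open T \<and> x \<in> T \<and> smooth_on T f"
  shows "smooth_on S f"
  using assms k_smooth_on_Union unfolding smooth_on_def by metis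

lemma smooth_on_const: "open S \<Longrightarrow> smooth_on S (\<lambda>x. c)"
  by (simp add: smooth_on_def k_smooth_on_const)

lemma smooth_on_id: "open S \<Longrightarrow> smooth_on S (\<lambda>x. x)"
  by (simp add: smooth_on_def k_smooth_on_id)

lemma smooth_on_linear:
  "bounded_linear L \<Longrightarrow> open S \<Longrightarrow> smooth_on S f \<Longrightarrow> smooth_on S (\<lambda>x. L (f x))"
  by (simp add: smooth_on_def k_smooth_on_linear)

lemma smooth_on_add:
  "open S \<Longrightarrow> smooth_on S f \<Longrightarrow> smooth_on S g \<Longrightarrow> smooth_on S (\<lambda>x. f x + g x)"
  by (simp add: smooth_on_def k_smooth_on_add)

lemma smooth_on_sum:
  "open S \<Longrightarrow> (\<And>i. i \<in> I \<Longrightarrow> smooth_on S (f i)) \<Longrightarrow> smooth_on S (\<lambda>x. \<Sum>i\<in>I. f i x)"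
  by (simp add: smooth_on_def k_smooth_on_sum)

lemma smooth_on_mult:
  fixes f g :: "'a::euclidean_space \<Rightarrow> real"
  shows "open S \<Longrightarrow> smooth_on S f \<Longrightarrow> smooth_on S g \<Longrightarrow> smooth_on S (\<lambda>x. f x * g x)"
  by (simp add: smooth_on_def k_smooth_on_mult)

lemma smooth_on_inverse:
  fixes f :: "'a::euclidean_space \<Rightarrow> real"
  shows "open S \<Longrightarrow> smooth_on S f \<Longrightarrow> (\<And>x. x \<in> S \<Longrightarrow> f x \<noteq> 0) \<Longrightarrow>
    smooth_on S (\<lambda>x. inverse (f x))"
  by (simp add: smooth_on_def k_smooth_on_inverse)

lemma smooth_on_compose:
  fixes f :: "'b::euclidean_space \<Rightarrow> real" and g :: "'a::euclidean_space \<Rightarrow> 'b"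
  shows "open S \<Longrightarrow> open T \<Longrightarrow> g ` S \<subseteq> T \<Longrightarrow> smooth_on T f \<Longrightarrow> smooth_on S g \<Longrightarrow>
    smooth_on S (\<lambda>x. f (g x))"
  by (simp add: smooth_on_def k_smooth_on_compose)

lemma smooth_on_frechet_derivative:
  "smooth_on S f \<Longrightarrow> smooth_on S (\<lambda>x. frechet_derivative f (at x) v)"
  unfolding smooth_on_def by (metis k_smooth_on.simps(2))

lemma smooth_on_has_derivative:
  "smooth_on S f \<Longrightarrow> x \<in> S \<Longrightarrow> (f has_derivative frechet_derivative f (at x)) (at x)"
  unfolding smooth_on_def by (metis k_smooth_on_has_derivative)

lemma smooth_on_continuous: "smooth_on S f \<Longrightarrow> continuous_on S f"
  unfolding smooth_on_def by (metis k_smooth_on_continuous)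

section \<open>Bump functions on Euclidean spaces\<close>

definition flat_exp :: "nat \<Rightarrow> real \<Rightarrow> real"
  where "flat_exp n t = (if t > 0 then exp (- 1 / t) / t ^ n else 0)"

text \<open>The power of \<open>t\<close> in the denominator makes the family closed under
  differentiation up to linear combinations, so smoothness of all members follows by one induction
  on the order with \<open>n\<close> arbitrary. The delicate point is \<open>t = 0\<close>.\<close>

lemma flat_exp_has_derivative:
  "(flat_exp n has_real_derivative flat_exp (n + 2) t - n * flat_exp (n + 1) t) (at t)"
proof -
  consider "t > 0" | "t < 0" | "t = 0" by linarith
  then show ?thesis
  proof cases
    case 1
    have "((\<lambda>t. exp (- 1 / t) / t ^ n) has_real_derivative
        (exp (- 1 / t) * (1 / t\<^sup>2) * t ^ n - exp (- 1 / t) * (n * t ^ (n - 1))) / (t ^ n * t ^ n)) (at t)"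
      using 1 by (auto intro!: derivative_eq_intros simp: power2_eq_square)
    also have "(exp (- 1 / t) * (1 / t\<^sup>2) * t ^ n - exp (- 1 / t) * (n * t ^ (n - 1))) / (t ^ n * t ^ n)
        = flat_exp (n + 2) t - n * flat_exp (n + 1) t"
      using 1 by (cases n) (simp_all add: flat_exp_def divide_simps power2_eq_square, simp_all add: algebra_simps)
    finally show ?thesis
      by (rule has_field_derivative_transform_within_open[where S = "{0<..}"])
        (use 1 in \<open>auto simp: flat_exp_def\<close>)
  next
    case 2
    have "((\<lambda>t. 0) has_real_derivative 0) (at t)" by simp
    then have "(flat_exp n has_real_derivative 0) (at t)"
      by (rule has_field_derivative_transform_within_open[where S = "{..<0}"])
        (use 2 in \<open>auto simp: flat_exp_def\<close>)
    then show ?thesis using 2 by (simp add: flat_exp_def)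
  next
    case 3
    \<comment> \<open>With \<open>t\<close> the inverse of \<open>h\<close>, this is the difference
      quotient of \<open>flat_exp n\<close> at 0 from the right; the additional factor comes from
      dividing by \<open>h\<close>.\<close>
    have "((\<lambda>t. exp (- t) * t ^ (n + 1)) \<longlongrightarrow> (0::real)) at_top"
      by real_asymp
    then have "((\<lambda>h. exp (- inverse h) * inverse h ^ (n + 1)) \<longlongrightarrow> (0::real)) (at_right 0)"
      by (rule filterlim_compose) (rule filterlim_inverse_at_top_right)
    then have r: "((\<lambda>h. flat_exp n h / h) \<longlongrightarrow> 0) (at_right 0)"
      by (rule Lim_transform_eventually)
        (auto simp: eventually_at_filter flat_exp_def field_simps)
    have l: "((\<lambda>h. flat_exp n h / h) \<longlongrightarrow> 0) (at_left 0)"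
      by (rule Lim_transform_eventually[of "\<lambda>_. 0"])
        (auto simp: eventually_at_filter flat_exp_def)
    have "((\<lambda>h. flat_exp n h / h) \<longlongrightarrow> 0) (at 0)"
      using l r by (simp add: filterlim_split_at)
    then show ?thesis
      using 3 by (simp add: DERIV_def flat_exp_def)
  qed
qed

lemma smooth_on_flat_exp: "smooth_on UNIV (flat_exp n)"
proof -
  have "k_smooth_on k UNIV (flat_exp n)" for k
  proof (induction k arbitrary: n)
    case 0
    show ?case
      unfolding k_smooth_on.simps
      by (intro continuous_at_imp_continuous_on ballI) (rule DERIV_isCont[OF flat_exp_has_derivative])
  next
    case (Suc k)
    show ?case
    proof (rule k_smooth_on_SucI)
      show "(flat_exp n has_derivative
          (\<lambda>v. (flat_exp (n + 2) x + (- real n) * flat_exp (n + 1) x) * v)) (at x)" for x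
        using flat_exp_has_derivative[of n x] by (simp add: has_field_derivative_def)
      show "k_smooth_on k UNIV
          (\<lambda>x. (flat_exp (n + 2) x + (- real n) * flat_exp (n + 1) x) * v)" for v
        using Suc by (intro k_smooth_on_mult k_smooth_on_add k_smooth_on_const) auto
    qed simp
  qed
  then show ?thesis by (simp add: smooth_on_def)
qed

lemma euclidean_bump:
  fixes a :: "'a::euclidean_space"
  assumes "r > 0"
  obtains b :: "'a \<Rightarrow> real" where "smooth_on UNIV b" "\<And>x. x \<in> cball a r \<Longrightarrow> b x = 1"
    "\<And>x. x \<notin> cball a (2 * r) \<Longrightarrow> b x = 0"
proof -
  define h where "h = flat_exp 0"
  have h: "h t = 0 \<longleftrightarrow> t \<le> 0" "h t \<ge> 0" for t
    by (auto simp: h_def flat_exp_def)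
  \<comment> \<open>A smooth step: 0 for nonpositive \<open>t\<close> and 1 for \<open>t\<close> at
    least 1. The denominator is positive because \<open>t\<close> and 1 - \<open>t\<close> are never
    both nonpositive.\<close>
  define s where "s = (\<lambda>t. h t * inverse (h t + h (1 + (- 1) * t)))"
  \<comment> \<open>The squared distance is used because it is polynomial in the coordinates. With
    the constant 2 the value is at least 1 on the ball of radius \<open>r\<close> and negative
    outside the ball of radius 2\<open>r\<close>.\<close>
  define d where "d = (\<lambda>x. 2 + (- 1 / r\<^sup>2) * (\<Sum>i\<in>Basis. (x \<bullet> i + - (a \<bullet> i)) * (x \<bullet> i + - (a \<bullet> i))))"
  have d: "d x = 2 - (dist x a / r)\<^sup>2" for x
    unfolding d_def dist_norm power_divide power2_norm_eq_inner euclidean_inner[of "x - a" "x - a"]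
    by (simp add: inner_diff_left)
  have h_smooth: "smooth_on UNIV h"
    by (simp add: h_def smooth_on_flat_exp)
  have "smooth_on UNIV (\<lambda>t::real. 1 + (- 1) * t)"
    by (intro smooth_on_add smooth_on_mult smooth_on_const smooth_on_id) simp_all
  then have "smooth_on UNIV (\<lambda>t. h (1 + (- 1) * t))"
    using smooth_on_compose[OF open_UNIV open_UNIV _ h_smooth] by simp
  moreover have "h t + h (1 + (- 1) * t) \<noteq> 0" for t
    using h[of t] h[of "1 + (- 1) * t"] by linarith
  ultimately have "smooth_on UNIV s"
    unfolding s_def
    by (intro smooth_on_mult smooth_on_inverse smooth_on_add h_smooth) simp_all
  moreover have "smooth_on UNIV d"
    unfolding d_def
    by (intro smooth_on_mult smooth_on_sum smooth_on_add smooth_on_const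
        smooth_on_linear[OF bounded_linear_inner_left] smooth_on_id) simp_all
  ultimately have "smooth_on UNIV (\<lambda>x. s (d x))"
    by (rule smooth_on_compose[OF open_UNIV open_UNIV subset_UNIV])
  moreover have "s (d x) = 1" if "x \<in> cball a r" for x
  proof -
    have "(dist x a / r)\<^sup>2 \<le> 1"
      using that assms by (intro power_le_one) (auto simp: dist_commute)
    then have "d x \<ge> 1" by (simp add: d)
    then have "h (1 + (- 1) * d x) = 0" "h (d x) \<noteq> 0"
      unfolding h(1) by simp_all
    then show ?thesis by (simp add: s_def)
  qed
  moreover have "s (d x) = 0" if "x \<notin> cball a (2 * r)" for x
  proof -
    have "2 < dist x a / r" using that assms by (auto simp: dist_commute field_simps)
    then have "2 < (dist x a / r)\<^sup>2"
      using mult_strict_mono[of 2 "dist x a / r" 1 "dist x a / r"] by (simp add: power2_eq_square)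
    then show ?thesis using h[of "d x"] by (auto simp: s_def d)
  qed
  ultimately show ?thesis using that by blast
qed

section \<open>Differentiation under the integral sign and Hadamard's lemma\<close>

lemma k_smooth_on_integral:
  fixes F :: "'a::euclidean_space \<times> real \<Rightarrow> real"
  assumes "k_smooth_on k UNIV F"
  shows "k_smooth_on k UNIV (\<lambda>x. integral {0..1} (\<lambda>t. F (x, t)))"
  using assms
proof (induction k arbitrary: F)
  case 0
  have "continuous_on UNIV (\<lambda>x. integral (cbox 0 1) (\<lambda>t. F (x, t)))"
    by (rule integral_continuous_on_param, rule continuous_on_subset[OF _ subset_UNIV])
      (use 0 in \<open>simp add: case_prod_unfold\<close>)
  then show ?case by simp
next
  case (Suc k)
  \<comment> \<open>Only the first argument varies, hence the direction \<open>(v, 0)\<close>. For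
    fixed \<open>v\<close> this is again a function of the pair, to which the induction hypothesis
    applies.\<close>
  let ?D = "\<lambda>x t v. frechet_derivative F (at (x, t)) (v, 0)"
  have D: "((\<lambda>x. F (x, t)) has_derivative ?D x t) (at x)" for x t
    by (rule has_derivative_compose[OF _ k_smooth_on_has_derivative[OF Suc.prems UNIV_I]])
      (intro has_derivative_Pair has_derivative_ident has_derivative_const)
  have bl: "bounded_linear (?D x t)" for x t
    by (rule has_derivative_bounded_linear[OF D])
  \<comment> \<open>\<open>leibniz_rule\<close> asks for a continuous family of bounded linear maps;
    in finite dimension its continuity can be checked vector by vector.\<close>
  define D' where "D' = (\<lambda>x t. Blinfun (?D x t))"
  have D': "blinfun_apply (D' x t) = ?D x t" for x t
    unfolding D'_def by (rule bounded_linear_Blinfun_apply[OF bl])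
  have cont: "continuous_on X (\<lambda>p. frechet_derivative F (at p) v)" for X v
    by (rule continuous_on_subset[OF k_smooth_on_continuous[of k] subset_UNIV])
      (use Suc.prems in \<open>cases v; simp\<close>)
  have contF: "continuous_on X F" for X
    by (rule continuous_on_subset[OF k_smooth_on_continuous[OF Suc.prems] subset_UNIV])
  have pair: "continuous_on {0..1} (\<lambda>t. (x, t))" for x :: 'a
    by (intro continuous_intros)
  have "continuous_on (UNIV \<times> cbox 0 1) (\<lambda>(x, t). D' x t)"
    by (rule continuous_on_blinfun_componentwise) (simp add: case_prod_unfold D' cont)
  moreover have "(\<lambda>t. F (x, t)) integrable_on cbox 0 1" for x
    unfolding cbox_interval
    by (rule integrable_continuous_interval[OF continuous_on_compose2[OF contF pair subset_UNIV]])
  ultimately have "((\<lambda>x. integral (cbox 0 1) (\<lambda>t. F (x, t))) has_derivative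
      integral (cbox 0 1) (D' x)) (at x)" for x
    by (intro leibniz_rule) (simp_all add: D' D)
  moreover have "integral (cbox 0 1) (D' x) v = integral {0..1} (\<lambda>t. ?D x t v)" for x v
  proof -
    have "continuous_on {0..1} (D' x)"
      unfolding D'
      by (intro continuous_on_blinfun_componentwise)
        (simp add: D' continuous_on_compose2[OF cont pair subset_UNIV])
    then have "D' x integrable_on {0..1}" by (rule integrable_continuous_interval)
    from integral_linear[OF this bounded_bilinear.bounded_linear_left[OF bounded_bilinear_blinfun_apply]]
    show ?thesis by (simp add: o_def D')
  qed
  moreover have "k_smooth_on k UNIV (\<lambda>x. integral {0..1} (\<lambda>t. ?D x t v))" for v
    using Suc.IH[of "\<lambda>p. frechet_derivative F (at p) (v, 0)"] Suc.prems by simp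
  ultimately show ?case
    by (intro k_smooth_on_SucI[where f' = "\<lambda>x. blinfun_apply (integral (cbox 0 1) (D' x))"]) simp_all
qed

text \<open>The fundamental theorem of calculus along the segment from \<open>a\<close> to
  \<open>y\<close> gives \<open>F y - F a\<close> as the integral of the derivative in direction
  \<open>y - a\<close>. Its linearity pulls out the coordinates, leaving as \<open>G i\<close> the
  mean of the partial derivative over the segment; for \<open>y = a\<close> the segment is a
  point.\<close>

lemma hadamard:
  fixes F :: "'a::euclidean_space \<Rightarrow> real"
  assumes "smooth_on UNIV F"
  obtains G where "\<And>i. i \<in> Basis \<Longrightarrow> smooth_on UNIV (G i)"
    "\<And>y. F y = F a + (\<Sum>i\<in>Basis. ((y - a) \<bullet> i) * G i y)"
    "\<And>i. G i a = frechet_derivative F (at a) i"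
proof -
  define G where "G = (\<lambda>i y. integral {0..1} (\<lambda>t. frechet_derivative F (at (a + t *\<^sub>R (y - a))) i))"
  show ?thesis
  proof
    show "G i a = frechet_derivative F (at a) i" for i
      by (simp add: G_def)
    have "smooth_on UNIV (\<lambda>p::'a \<times> real. a + snd p *\<^sub>R (fst p - a))"
    proof -
      \<comment> \<open>The product rule \<open>k_smooth_on_mult\<close> is for real factors. Here
        the derivative in a fixed direction is affine in \<open>p\<close>, so one differentiation
        settles every order.\<close>
      have "k_smooth_on k UNIV (\<lambda>p::'a \<times> real. snd p *\<^sub>R (fst p - a))" for k
      proof (cases k)
        case 0
        then show ?thesis by (auto intro!: continuous_intros)
      next
        case (Suc k)
        have "k_smooth_on k UNIV (\<lambda>p::'a \<times> real. snd p *\<^sub>R fst v + snd v *\<^sub>R (fst p + - a))" for v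
          by (intro k_smooth_on_add k_smooth_on_const k_smooth_on_id
              k_smooth_on_linear[OF bounded_linear_fst] k_smooth_on_linear[OF bounded_linear_scaleR_right]
              k_smooth_on_linear[OF bounded_linear_compose[OF bounded_linear_scaleR_left bounded_linear_snd]])
            auto
        then show ?thesis
          unfolding Suc
          by (intro k_smooth_on_SucI[where f' = "\<lambda>p v. snd p *\<^sub>R fst v + snd v *\<^sub>R (fst p + - a)"])
            (auto intro!: derivative_eq_intros)
      qed
      then show ?thesis
        by (intro smooth_on_add smooth_on_const) (auto simp: smooth_on_def)
    qed
    then have "smooth_on UNIV (\<lambda>p. frechet_derivative F (at (a + snd p *\<^sub>R (fst p - a))) i)" for i
      using smooth_on_compose[OF _ _ _ smooth_on_frechet_derivative[OF assms], of UNIV] by auto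
    from this k_smooth_on_integral[of _ "\<lambda>p. frechet_derivative F (at (a + snd p *\<^sub>R (fst p - a))) _"]
    show "smooth_on UNIV (G i)" for i
      by (simp add: G_def smooth_on_def)
    fix y
    have lin: "linear (frechet_derivative F (at z))" for z
      using smooth_on_has_derivative[OF assms] by (meson UNIV_I has_derivative_linear)
    have eq: "frechet_derivative F (at z) w = (\<Sum>i\<in>Basis. (w \<bullet> i) * frechet_derivative F (at z) i)"
      for z w
      by (subst euclidean_representation[of w, symmetric])
        (simp add: linear_sum[OF lin] linear_scale[OF lin] del: euclidean_representation)
    let ?c = "\<lambda>t. a + t *\<^sub>R (y - a)"
    have "((\<lambda>t. F (?c t)) has_vector_derivative frechet_derivative F (at (?c t)) (y - a)) (at t within {0..1})"
      for t
    proof -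
      have "((\<lambda>t. F (?c t)) has_derivative (\<lambda>s. frechet_derivative F (at (?c t)) (s *\<^sub>R (y - a)))) (at t within {0..1})"
        by (rule has_derivative_compose[OF _ smooth_on_has_derivative[OF assms]])
          (auto intro!: derivative_eq_intros)
      then show ?thesis
        by (simp add: has_vector_derivative_def linear_scale[OF lin])
    qed
    then have "((\<lambda>t. frechet_derivative F (at (?c t)) (y - a)) has_integral F (?c 1) - F (?c 0)) {0..1}"
      by (intro fundamental_theorem_of_calculus) auto
    then have "F y - F a = integral {0..1} (\<lambda>t. frechet_derivative F (at (?c t)) (y - a))"
      by (simp add: integral_unique)
    also have "\<dots> = integral {0..1} (\<lambda>t. \<Sum>i\<in>Basis. ((y - a) \<bullet> i) * frechet_derivative F (at (?c t)) i)"
      by (intro arg_cong[where f = "integral {0..1}"] ext eq)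
    also have "\<dots> = (\<Sum>i\<in>Basis. ((y - a) \<bullet> i) * G i y)"
    proof -
      have "continuous_on {0..1} (\<lambda>t. frechet_derivative F (at (?c t)) i)" for i
        by (rule continuous_on_compose2[OF smooth_on_continuous[OF smooth_on_frechet_derivative[OF assms]]])
          (auto intro!: continuous_intros)
      then have "(\<lambda>t. frechet_derivative F (at (?c t)) i) integrable_on {0..1}" for i
        by (rule integrable_continuous_interval)
      then show ?thesis
        by (subst integral_sum) (auto simp: G_def integrable_on_mult_right)
    qed
    finally show "F y = F a + (\<Sum>i\<in>Basis. ((y - a) \<bullet> i) * G i y)" by simp
  qed
qed

section \<open>Local analysis on a manifold\<close>

text \<open>A relative version of membership in \<open>smooth_functions\<close>, meant for open
  \<open>W\<close>: coefficients that are smooth only near a point are handled with it before they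
  are cut off or glued.\<close>

definition smooth_fun_on :: "('m, 'n::finite) chart set \<Rightarrow> 'm set \<Rightarrow> ('m \<Rightarrow> real) \<Rightarrow> bool"
  where "smooth_fun_on A W f \<longleftrightarrow> (\<forall>(V, \<psi>)\<in>A. smooth_on (\<psi> ` (V \<inter> W)) (f \<circ> inv_into V \<psi>))"

lemma smooth_functions_iff: "f \<in> smooth_functions A \<longleftrightarrow> smooth_fun_on A UNIV f"
  by (simp add: smooth_functions_def smooth_fun_on_def)

lemma smooth_fun_onD:
  "smooth_fun_on A W f \<Longrightarrow> (V, \<psi>) \<in> A \<Longrightarrow> smooth_on (\<psi> ` (V \<inter> W)) (\<lambda>y. f (inv_into V \<psi> y))"
  by (auto simp: smooth_fun_on_def o_def)

lemma smooth_fun_onI: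
  "(\<And>V \<psi>. (V, \<psi>) \<in> A \<Longrightarrow> smooth_on (\<psi> ` (V \<inter> W)) (\<lambda>y. f (inv_into V \<psi> y))) \<Longrightarrow>
    smooth_fun_on A W f"
  by (auto simp: smooth_fun_on_def o_def)

lemma smooth_fun_on_subset: "smooth_fun_on A W f \<Longrightarrow> W' \<subseteq> W \<Longrightarrow> smooth_fun_on A W' f"
  by (rule smooth_fun_onI, rule smooth_on_subset, rule smooth_fun_onD) auto

lemma smooth_functions_imp_smooth_fun_on: "f \<in> smooth_functions A \<Longrightarrow> smooth_fun_on A W f"
  unfolding smooth_functions_iff by (rule smooth_fun_on_subset[OF _ subset_UNIV])

lemma sum_fun_apply: "(\<Sum>i\<in>I. f i) x = (\<Sum>i\<in>I. f i x)"
  by (induction I rule: infinite_finite_induct) auto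

section \<open>Charts and functions smooth on open sets\<close>

locale manifold =
  fixes A :: "('m::{t2_space,second_countable_topology}, 'n::finite) chart set"
  assumes smooth_manifold: "smooth_manifold A"
begin

lemma chart:
  assumes "(U, \<phi>) \<in> A"
  shows "open U" "homeomorphism U (\<phi> ` U) \<phi> (inv_into U \<phi>)" "inj_on \<phi> U" "continuous_on U \<phi>"
proof -
  have *: "is_chart (U, \<phi>)"
    using assms smooth_manifold by (auto simp: smooth_manifold_def)
  then show "open U" and hom: "homeomorphism U (\<phi> ` U) \<phi> (inv_into U \<phi>)"
    by (auto simp: is_chart_def)
  then show "inj_on \<phi> U" "continuous_on U \<phi>"
    by (auto simp: homeomorphism_def intro: inj_on_inverseI)
qed

lemma open_chart_image:
  assumes "(U, \<phi>) \<in> A" "open W"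
  shows "open (\<phi> ` (U \<inter> W))"
proof -
  have "open (\<phi> ` U)"
    using assms smooth_manifold by (auto simp: smooth_manifold_def is_chart_def)
  moreover have "openin (top_of_set (\<phi> ` U)) (\<phi> ` (U \<inter> W))"
    using chart(2)[OF assms(1)] assms(2) by (intro homeomorphism_imp_open_map) auto
  ultimately show ?thesis
    using openin_open_trans by blast
qed

lemma inv_chart: "(U, \<phi>) \<in> A \<Longrightarrow> q \<in> U \<Longrightarrow> inv_into U \<phi> (\<phi> q) = q"
  using chart(3) by simp

lemma chart_at: obtains U \<phi> where "(U, \<phi>) \<in> A" "p \<in> U"
proof -
  have "p \<in> (\<Union>c\<in>A. fst c)"
    using smooth_manifold by (simp add: smooth_manifold_def)
  then show ?thesis using that by auto
qed

lemma smooth_fun_on_Union: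
  assumes "\<And>p. p \<in> W \<Longrightarrow> \<exists>N. open N \<and> p \<in> N \<and> smooth_fun_on A N f"
  shows "smooth_fun_on A W f"
proof (rule smooth_fun_onI)
  fix V \<psi> assume V: "(V, \<psi>) \<in> A"
  show "smooth_on (\<psi> ` (V \<inter> W)) (\<lambda>y. f (inv_into V \<psi> y))"
  proof (rule smooth_on_Union)
    fix y assume "y \<in> \<psi> ` (V \<inter> W)"
    then obtain p where p: "p \<in> V" "p \<in> W" "y = \<psi> p" by auto
    obtain N where N: "open N" "p \<in> N" "smooth_fun_on A N f"
      using assms p by blast
    show "\<exists>T. open T \<and> y \<in> T \<and> smooth_on T (\<lambda>y. f (inv_into V \<psi> y))"
    proof (intro exI conjI)
      show "open (\<psi> ` (V \<inter> N))" by (rule open_chart_image[OF V N(1)])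
      show "y \<in> \<psi> ` (V \<inter> N)" using p N by auto
      show "smooth_on (\<psi> ` (V \<inter> N)) (\<lambda>y. f (inv_into V \<psi> y))"
        by (rule smooth_fun_onD[OF N(3) V])
    qed
  qed
qed

lemma smooth_fun_on_cong:
  assumes "open W" "smooth_fun_on A W f" "\<And>p. p \<in> W \<Longrightarrow> f p = g p"
  shows "smooth_fun_on A W g"
proof (rule smooth_fun_onI)
  fix V \<psi> assume V: "(V, \<psi>) \<in> A"
  have "f (inv_into V \<psi> y) = g (inv_into V \<psi> y)" if "y \<in> \<psi> ` (V \<inter> W)" for y
    using that assms(3) inv_chart[OF V] by auto
  then show "smooth_on (\<psi> ` (V \<inter> W)) (\<lambda>y. g (inv_into V \<psi> y))"
    by (rule iffD1[OF smooth_on_cong[OF open_chart_image[OF V assms(1)]] smooth_fun_onD[OF assms(2) V]])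
qed

lemma smooth_fun_on_const: "open W \<Longrightarrow> smooth_fun_on A W (\<lambda>p. c)"
  by (rule smooth_fun_onI) (intro smooth_on_const open_chart_image)

lemma smooth_fun_on_add:
  "open W \<Longrightarrow> smooth_fun_on A W f \<Longrightarrow> smooth_fun_on A W g \<Longrightarrow> smooth_fun_on A W (\<lambda>p. f p + g p)"
  by (rule smooth_fun_onI) (intro smooth_on_add open_chart_image smooth_fun_onD)

lemma smooth_fun_on_mult:
  "open W \<Longrightarrow> smooth_fun_on A W f \<Longrightarrow> smooth_fun_on A W g \<Longrightarrow> smooth_fun_on A W (\<lambda>p. f p * g p)"
  by (rule smooth_fun_onI) (intro smooth_on_mult open_chart_image smooth_fun_onD)

lemma smooth_fun_on_inverse:
  assumes "open W" "smooth_fun_on A W f" "\<And>p. p \<in> W \<Longrightarrow> f p \<noteq> 0"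
  shows "smooth_fun_on A W (\<lambda>p. inverse (f p))"
proof (rule smooth_fun_onI)
  fix V \<psi> assume V: "(V, \<psi>) \<in> A"
  have "f (inv_into V \<psi> y) \<noteq> 0" if "y \<in> \<psi> ` (V \<inter> W)" for y
    using that assms(3) inv_chart[OF V] by auto
  then show "smooth_on (\<psi> ` (V \<inter> W)) (\<lambda>y. inverse (f (inv_into V \<psi> y)))"
    by (rule smooth_on_inverse[OF open_chart_image[OF V assms(1)] smooth_fun_onD[OF assms(2) V]])
qed

lemma smooth_fun_on_sum:
  assumes "open W" "\<And>i. i \<in> I \<Longrightarrow> smooth_fun_on A W (f i)"
  shows "smooth_fun_on A W (\<lambda>p. \<Sum>i\<in>I. f i p)"
  using assms(2)
proof (induction I rule: infinite_finite_induct)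
  case (insert i I)
  then show ?case by (simp add: smooth_fun_on_add[OF assms(1)])
qed (simp_all add: smooth_fun_on_const[OF assms(1)])

lemma smooth_fun_on_prod:
  assumes "open W" "\<And>i. i \<in> I \<Longrightarrow> smooth_fun_on A W (f i)"
  shows "smooth_fun_on A W (\<lambda>p. \<Prod>i\<in>I. f i p)"
  using assms(2)
proof (induction I rule: infinite_finite_induct)
  case (insert i I)
  then show ?case by (simp add: smooth_fun_on_mult[OF assms(1)])
qed (simp_all add: smooth_fun_on_const[OF assms(1)])

lemma smooth_fun_on_det:
  fixes M :: "'m \<Rightarrow> real^'k^'k"
  assumes "open W" "\<And>i j. smooth_fun_on A W (\<lambda>p. M p $ i $ j)"
  shows "smooth_fun_on A W (\<lambda>p. det (M p))"
  unfolding det_def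
  by (intro smooth_fun_on_sum smooth_fun_on_mult smooth_fun_on_prod smooth_fun_on_const assms)

text \<open>Seen in another chart, the function is \<open>h\<close> after the transition map, which
  is smooth by the compatibility of the atlas.\<close>

lemma smooth_fun_on_chart:
  fixes h :: "real^'n \<Rightarrow> real"
  assumes U: "(U, \<phi>) \<in> A" and h: "smooth_on (\<phi> ` U) h"
  shows "smooth_fun_on A U (\<lambda>q. h (\<phi> q))"
proof (rule smooth_fun_onI)
  fix V \<psi> assume V: "(V, \<psi>) \<in> A"
  have "smooth_on (\<psi> ` (V \<inter> U)) (\<phi> \<circ> inv_into V \<psi>)"
    using smooth_manifold U V unfolding smooth_manifold_def by blast
  then have "smooth_on (\<psi> ` (V \<inter> U)) (\<lambda>y. \<phi> (inv_into V \<psi> y))"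
    by (simp add: o_def)
  moreover have "(\<lambda>y. \<phi> (inv_into V \<psi> y)) ` \<psi> ` (V \<inter> U) \<subseteq> \<phi> ` U"
    using inv_chart[OF V] by auto
  ultimately show "smooth_on (\<psi> ` (V \<inter> U)) (\<lambda>y. h (\<phi> (inv_into V \<psi> y)))"
    using open_chart_image[OF V chart(1)[OF U]] open_chart_image[OF U open_UNIV]
    by (intro smooth_on_compose[OF _ _ _ h]) simp_all
qed

section \<open>Global smooth functions and bump functions in charts\<close>

lemma smooth_functions_const: "(\<lambda>p. c) \<in> smooth_functions A"
  by (simp add: smooth_functions_iff smooth_fun_on_const)

lemma smooth_functions_add:
  "f \<in> smooth_functions A \<Longrightarrow> g \<in> smooth_functions A \<Longrightarrow> f + g \<in> smooth_functions A"
  using smooth_fun_on_add[OF open_UNIV] by (simp add: smooth_functions_iff plus_fun_def)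

lemma smooth_functions_mult:
  "f \<in> smooth_functions A \<Longrightarrow> g \<in> smooth_functions A \<Longrightarrow> f * g \<in> smooth_functions A"
  using smooth_fun_on_mult[OF open_UNIV] by (simp add: smooth_functions_iff times_fun_def)

lemma smooth_functions_scaleR: "f \<in> smooth_functions A \<Longrightarrow> c *\<^sub>R f \<in> smooth_functions A"
  using smooth_functions_mult[OF smooth_functions_const] by (simp add: times_fun_def scaleR_fun_def)

lemma smooth_functions_sum:
  "(\<And>i. i \<in> I \<Longrightarrow> f i \<in> smooth_functions A) \<Longrightarrow> (\<lambda>p. \<Sum>i\<in>I. f i p) \<in> smooth_functions A"
  by (simp add: smooth_functions_iff smooth_fun_on_sum)

text \<open>The open sets \<open>U\<close> and \<open>- K\<close> cover the manifold;
  \<open>f\<close> is smooth on the first by assumption and zero on the second.\<close>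

lemma smooth_functions_zero_outside:
  assumes "open U" "closed K" "K \<subseteq> U" "smooth_fun_on A U f" "\<And>p. p \<notin> K \<Longrightarrow> f p = 0"
  shows "f \<in> smooth_functions A"
  unfolding smooth_functions_iff
proof (rule smooth_fun_on_Union)
  fix p
  show "\<exists>N. open N \<and> p \<in> N \<and> smooth_fun_on A N f"
  proof (cases "p \<in> U")
    case False
    have "smooth_fun_on A (- K) f"
      by (rule smooth_fun_on_cong[OF _ smooth_fun_on_const[of _ 0]]) (use assms in auto)
    then show ?thesis using False assms by (intro exI[of _ "- K"]) auto
  qed (use assms in auto)
qed

text \<open>\<open>K\<close> is compact rather than just closed so that its image under \<phi> is
  closed in the coordinate space, which allows extension by zero there as well; in the Hausdorff
  manifold it is closed too. The set \<open>N\<close> where \<open>b\<close> is 1 is open, so that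
  one bump function serves all points near a given one.\<close>

definition chart_bump :: "'m set \<Rightarrow> ('m \<Rightarrow> real^'n) \<Rightarrow> 'm set \<Rightarrow> 'm set \<Rightarrow> ('m \<Rightarrow> real) \<Rightarrow> bool"
  where "chart_bump U \<phi> N K b \<longleftrightarrow> (U, \<phi>) \<in> A \<and> open N \<and> N \<subseteq> K \<and> compact K \<and> K \<subseteq> U \<and>
    b \<in> smooth_functions A \<and> (\<forall>q\<in>N. b q = 1) \<and> (\<forall>q. q \<notin> K \<longrightarrow> b q = 0)"

lemma ex_chart_bump:
  assumes U: "(U, \<phi>) \<in> A" and "p \<in> U" "open W" "p \<in> W"
  obtains N K b where "chart_bump U \<phi> N K b" "p \<in> N" "K \<subseteq> W"
proof -
  have "open (\<phi> ` (U \<inter> W))" "\<phi> p \<in> \<phi> ` (U \<inter> W)"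
    using open_chart_image assms by auto
  then obtain e where e: "e > 0" "cball (\<phi> p) e \<subseteq> \<phi> ` (U \<inter> W)"
    using open_contains_cball by blast
  \<comment> \<open>The Euclidean bump is 1 up to radius \<open>r\<close> and vanishes beyond
    2\<open>r\<close>, which is the radius \<open>e\<close> known to fit into the chart.\<close>
  define r where "r = e / 2"
  have r: "r > 0" "cball (\<phi> p) (2 * r) \<subseteq> \<phi> ` (U \<inter> W)"
    using e by (auto simp: r_def)
  obtain \<beta> :: "real^'n \<Rightarrow> real" where \<beta>: "smooth_on UNIV \<beta>" "\<And>x. x \<in> cball (\<phi> p) r \<Longrightarrow> \<beta> x = 1"
    "\<And>x. x \<notin> cball (\<phi> p) (2 * r) \<Longrightarrow> \<beta> x = 0"
    by (rule euclidean_bump[OF r(1), of "\<phi> p"]) blast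
  define K where "K = inv_into U \<phi> ` cball (\<phi> p) (2 * r)"
  define N where "N = U \<inter> \<phi> -` ball (\<phi> p) r"
  define b where "b = (\<lambda>q. if q \<in> U then \<beta> (\<phi> q) else 0)"
  have KU: "K \<subseteq> U \<inter> W"
    using r(2) inv_chart[OF U] unfolding K_def by fastforce
  have in_K: "q \<in> K" if "q \<in> U" "\<phi> q \<in> cball (\<phi> p) (2 * r)" for q
    using that inv_chart[OF U that(1)] unfolding K_def by (metis imageI)
  have compact: "compact K"
    unfolding K_def
  proof (rule compact_continuous_image)
    have "continuous_on (\<phi> ` U) (inv_into U \<phi>)"
      using chart(2)[OF U] by (simp add: homeomorphism_def)
    then show "continuous_on (cball (\<phi> p) (2 * r)) (inv_into U \<phi>)"
      by (rule continuous_on_subset) (use r(2) in auto)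
  qed simp
  have zero: "b q = 0" if "q \<notin> K" for q
    using that in_K \<beta>(3) by (auto simp: b_def)
  have "smooth_fun_on A U (\<lambda>q. \<beta> (\<phi> q))"
    by (rule smooth_fun_on_chart[OF U smooth_on_subset[OF \<beta>(1)]]) simp
  then have "smooth_fun_on A U b"
    by (rule smooth_fun_on_cong[OF chart(1)[OF U]]) (simp add: b_def)
  then have "b \<in> smooth_functions A"
    using KU compact zero chart(1)[OF U]
    by (intro smooth_functions_zero_outside[of U K]) (auto intro: compact_imp_closed)
  moreover have "open N"
    unfolding N_def by (rule continuous_open_preimage[OF chart(4)[OF U] chart(1)[OF U]]) simp
  moreover have "N \<subseteq> K"
    using in_K r(1) unfolding N_def by force
  moreover have "\<forall>q\<in>N. b q = 1"
    using \<beta>(2) by (auto simp: N_def b_def)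
  moreover have "p \<in> N" using assms r(1) by (auto simp: N_def)
  ultimately show ?thesis
    using that[of N K b] KU compact zero U unfolding chart_bump_def by blast
qed

text \<open>Makes a function that is smooth only on the chart domain acceptable to tangent vectors.
  Outside that domain the values of \<open>f\<close> are arbitrary and are annihilated by
  \<open>b\<close>.\<close>

lemma smooth_functions_mult_bump:
  assumes "chart_bump U \<phi> N K b" "smooth_fun_on A U f"
  shows "(\<lambda>q. b q * f q) \<in> smooth_functions A"
proof (rule smooth_functions_zero_outside)
  show "open U" using assms chart(1) by (auto simp: chart_bump_def)
  then show "smooth_fun_on A U (\<lambda>q. b q * f q)"
    using assms by (intro smooth_fun_on_mult) (auto simp: chart_bump_def smooth_functions_imp_smooth_fun_on)
  show "closed K" "K \<subseteq> U" using assms by (auto simp: chart_bump_def compact_imp_closed)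
qed (use assms in \<open>auto simp: chart_bump_def\<close>)

section \<open>Derivations at a point\<close>

lemma tangent_space_add:
  "v \<in> tangent_space A p \<Longrightarrow> f \<in> smooth_functions A \<Longrightarrow> h \<in> smooth_functions A \<Longrightarrow> v (f + h) = v f + v h"
  by (simp add: tangent_space_def)

lemma tangent_space_mult:
  "v \<in> tangent_space A p \<Longrightarrow> f \<in> smooth_functions A \<Longrightarrow> h \<in> smooth_functions A \<Longrightarrow>
    v (f * h) = f p * v h + h p * v f"
  by (simp add: tangent_space_def)

lemma tangent_space_scaleR:
  "v \<in> tangent_space A p \<Longrightarrow> f \<in> smooth_functions A \<Longrightarrow> v (c *\<^sub>R f) = c * v f"
  by (simp add: tangent_space_def)

text \<open>The Leibniz rule for 1 * 1 = 1 doubles the value on 1, which is therefore zero;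
  homogeneity does the rest.\<close>

lemma tangent_space_const:
  assumes "v \<in> tangent_space A p"
  shows "v (\<lambda>q. c) = 0"
proof -
  have "v ((\<lambda>q. 1) * (\<lambda>q. 1)) = v (\<lambda>q. 1) + v (\<lambda>q. 1)"
    using tangent_space_mult[OF assms smooth_functions_const smooth_functions_const] by simp
  moreover have "(\<lambda>q::'m. 1::real) * (\<lambda>q. 1) = (\<lambda>q. 1)" "(\<lambda>q::'m. c) = c *\<^sub>R (\<lambda>q. 1)"
    by (auto simp: times_fun_def scaleR_fun_def)
  ultimately show ?thesis
    using tangent_space_scaleR[OF assms smooth_functions_const, of c 1] by simp
qed

lemma tangent_space_sum:
  assumes "v \<in> tangent_space A p" "\<And>i. i \<in> I \<Longrightarrow> f i \<in> smooth_functions A"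
  shows "v (\<lambda>q. \<Sum>i\<in>I. f i q) = (\<Sum>i\<in>I. v (f i))"
  using assms(2)
proof (induction I rule: infinite_finite_induct)
  case (insert i I)
  have "(\<lambda>q. \<Sum>j\<in>insert i I. f j q) = f i + (\<lambda>q. \<Sum>j\<in>I. f j q)"
    using insert by (auto simp: plus_fun_def)
  then show ?case
    using insert tangent_space_add[OF assms(1), of "f i" "\<lambda>q. \<Sum>j\<in>I. f j q"]
    by (simp add: smooth_functions_sum)
qed (simp_all add: tangent_space_const[OF assms(1)])

text \<open>A bump function \<open>b\<close> supported in \<open>N\<close> with
  \<open>b p = 1\<close> makes \<open>b * f\<close> and \<open>b * h\<close> equal everywhere.
  Expanding both by the Leibniz rule, the terms containing \<open>v b\<close> agree because
  \<open>f p = h p\<close>.\<close>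

lemma tangent_space_local:
  assumes v: "v \<in> tangent_space A p" and fh: "f \<in> smooth_functions A" "h \<in> smooth_functions A"
    and N: "open N" "p \<in> N" "\<And>q. q \<in> N \<Longrightarrow> f q = h q"
  shows "v f = v h"
proof -
  obtain U \<phi> where U: "(U, \<phi>) \<in> A" "p \<in> U" by (rule chart_at)
  obtain N' K b where b: "chart_bump U \<phi> N' K b" "p \<in> N'" "K \<subseteq> N"
    using ex_chart_bump[OF U N(1,2)] .
  have b': "b \<in> smooth_functions A" "b p = 1" "\<And>q. q \<notin> N \<Longrightarrow> b q = 0"
    using b by (auto simp: chart_bump_def)
  have "b * f = b * h"
    using N(3) b'(3) by (fastforce simp: times_fun_def)
  then have "v (b * f) = v (b * h)" by simp
  then show ?thesis
    using tangent_space_mult[OF v b'(1) fh(1)] tangent_space_mult[OF v b'(1) fh(2)] b'(2) N by simp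
qed

lemma tangent_space_subspace: "subspace (tangent_space A p)"
  unfolding subspace_def tangent_space_def
  by (auto simp: scaleR_fun_def algebra_simps)

text \<open>Hadamard's lemma at \<phi>(q) writes \<open>f\<close> near \<open>q\<close> as a
  constant plus products of coordinate differences with smooth functions. A derivation kills the
  constant and, since the differences vanish at \<open>q\<close>, sees only their derivatives times
  the values of the other factors, which are the partial derivatives. The coordinates carry the
  factor \<open>b\<close> to be global functions.\<close>

lemma derivation_coordinates:
  assumes b: "chart_bump U \<phi> N K b" and q: "q \<in> N" and v: "v \<in> tangent_space A q"
    and f: "f \<in> smooth_functions A"
  shows "v f = (\<Sum>i\<in>UNIV. v (\<lambda>p. b p * \<phi> p $ i) *
    frechet_derivative (f \<circ> inv_into U \<phi>) (at (\<phi> q)) (axis i 1))"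
proof -
  have U: "(U, \<phi>) \<in> A" and N: "open N" "N \<subseteq> U" "\<And>p. p \<in> N \<Longrightarrow> b p = 1"
    and K: "compact K" "K \<subseteq> U" "\<And>p. p \<notin> K \<Longrightarrow> b p = 0" and bs: "b \<in> smooth_functions A"
    using b by (auto simp: chart_bump_def)
  note inv = inv_chart[OF U]
  have openU: "open (\<phi> ` U)" using open_chart_image[OF U open_UNIV] by simp
  \<comment> \<open>\<open>hadamard\<close> wants a function on the whole space, so
    \<open>b * f\<close> rather than \<open>f\<close> is transported and extended by zero.\<close>
  define F where "F = (\<lambda>y. if y \<in> \<phi> ` U then b (inv_into U \<phi> y) * f (inv_into U \<phi> y) else 0)"
  have bf: "smooth_on (\<phi> ` U) (\<lambda>y. b (inv_into U \<phi> y) * f (inv_into U \<phi> y))"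
    using smooth_fun_onD[OF smooth_functions_imp_smooth_fun_on[OF bs, of UNIV] U]
      smooth_fun_onD[OF smooth_functions_imp_smooth_fun_on[OF f, of UNIV] U]
    by (intro smooth_on_mult[OF openU]) simp_all
  have "smooth_on UNIV F"
  proof (rule smooth_on_Union)
    fix y
    show "\<exists>T. open T \<and> y \<in> T \<and> smooth_on T F"
    proof (cases "y \<in> \<phi> ` U")
      case True
      have "smooth_on (\<phi> ` U) F"
        by (rule iffD1[OF smooth_on_cong[OF openU] bf]) (simp add: F_def)
      then show ?thesis using True openU by (intro exI[of _ "\<phi> ` U"]) simp
    next
      case False
      \<comment> \<open>Compactness makes this image closed, so its complement is an open set around
        \<open>y\<close> on which \<open>F\<close> vanishes.\<close>
      have "compact (\<phi> ` K)"
        using K chart(4)[OF U] by (intro compact_continuous_image) (auto intro: continuous_on_subset)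
      then have op: "open (- \<phi> ` K)" by (auto dest: compact_imp_closed)
      have "F y = 0" if "y \<in> - \<phi> ` K" for y
      proof (cases "y \<in> \<phi> ` U")
        case True
        then obtain x where "x \<in> U" "y = \<phi> x" by auto
        moreover have "x \<notin> K" using that \<open>y = \<phi> x\<close> by auto
        ultimately have "b x = 0" using K(3) by simp
        then show ?thesis using \<open>x \<in> U\<close> \<open>y = \<phi> x\<close> inv by (simp add: F_def)
      next
        case False
        then show ?thesis by (simp add: F_def)
      qed
      then have "smooth_on (- \<phi> ` K) F"
        by (intro iffD1[OF smooth_on_cong[OF op] smooth_on_const[OF op, of 0]]) simp
      then show ?thesis using False K(2) op by (intro exI[of _ "- \<phi> ` K"]) auto
    qed
  qed
  then obtain G where
    G: "\<And>i. i \<in> Basis \<Longrightarrow> smooth_on UNIV (G i)"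
      "\<And>y. F y = F (\<phi> q) + (\<Sum>i\<in>Basis. ((y - \<phi> q) \<bullet> i) * G i y)"
      "\<And>i. G i (\<phi> q) = frechet_derivative F (at (\<phi> q)) i"
    by (rule hadamard[of F "\<phi> q"]) blast
  let ?e = "\<lambda>i::'n. axis i (1::real)"
  have sum_Basis: "(\<Sum>i\<in>Basis. k i) = (\<Sum>i\<in>UNIV. k (?e i))" for k :: "real^'n \<Rightarrow> real"
  proof -
    have "Basis = range ?e" by (auto simp: Basis_vec_def)
    moreover have "inj ?e" by (auto simp: inj_def axis_eq_axis)
    ultimately show ?thesis using sum.reindex[of ?e UNIV k] by (simp add: o_def)
  qed
  define x where "x = (\<lambda>i p. b p * \<phi> p $ i)"
  define g where "g = (\<lambda>i p. b p * G (?e i) (\<phi> p))"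
  have x: "x i \<in> smooth_functions A" for i
    unfolding x_def
    by (intro smooth_functions_mult_bump[OF b] smooth_fun_on_chart[OF U] openU
        smooth_on_linear[OF bounded_linear_vec_nth] smooth_on_id)
  have g: "g i \<in> smooth_functions A" for i
    unfolding g_def
    by (intro smooth_functions_mult_bump[OF b] smooth_fun_on_chart[OF U] smooth_on_subset[OF G(1) subset_UNIV])
      simp
  have F_eq: "F (\<phi> p) = f p" if "p \<in> N" for p
  proof -
    have "p \<in> U" using that N(2) by auto
    then show ?thesis by (simp add: F_def inv N(3)[OF that])
  qed
  \<comment> \<open>The expansion holds only on \<open>N\<close>, where both occurrences of
    \<open>b\<close> are 1; locality of \<open>v\<close> is what permits the replacement.\<close>
  have "v f = v (\<lambda>p. f q + (\<Sum>i\<in>UNIV. (x i p - x i q) * g i p))"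
  proof (rule tangent_space_local[OF v f _ N(1) q])
    show "f p = f q + (\<Sum>i\<in>UNIV. (x i p - x i q) * g i p)" if "p \<in> N" for p
    proof -
      have "f p = f q + (\<Sum>i\<in>UNIV. ((\<phi> p - \<phi> q) \<bullet> ?e i) * G (?e i) (\<phi> p))"
        using G(2)[of "\<phi> p"] F_eq[OF that] F_eq[OF q] unfolding sum_Basis by simp
      then show ?thesis
        using N(3)[OF that] N(3)[OF q] by (simp add: x_def g_def inner_axis)
    qed
    have "(\<lambda>p. (x i p - x i q) * g i p) \<in> smooth_functions A" for i
      using smooth_functions_mult[OF smooth_functions_add[OF x[of i] smooth_functions_const[of "- x i q"]] g[of i]]
      by (simp add: times_fun_def plus_fun_def)
    then show "(\<lambda>p. f q + (\<Sum>i\<in>UNIV. (x i p - x i q) * g i p)) \<in> smooth_functions A"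
      using smooth_functions_add[OF smooth_functions_const[of "f q"]
          smooth_functions_sum[of UNIV "\<lambda>i p. (x i p - x i q) * g i p"]]
      by (simp add: plus_fun_def)
  qed
  also have "(\<lambda>p. f q + (\<Sum>i\<in>UNIV. (x i p - x i q) * g i p)) =
      (\<lambda>p. f q) + (\<lambda>p. \<Sum>i\<in>UNIV. ((x i + (\<lambda>p. - x i q)) * g i) p)"
    by (simp add: plus_fun_def times_fun_def)
  also have "v \<dots> = (\<Sum>i\<in>UNIV. v ((x i + (\<lambda>p. - x i q)) * g i))"
  proof -
    have xg: "(x i + (\<lambda>p. - x i q)) * g i \<in> smooth_functions A" for i
      by (intro smooth_functions_mult smooth_functions_add smooth_functions_const x g)
    show ?thesis
      unfolding tangent_space_add[OF v smooth_functions_const smooth_functions_sum[OF xg]]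
        tangent_space_sum[OF v xg] tangent_space_const[OF v] by simp
  qed
  also have "\<dots> = (\<Sum>i\<in>UNIV. g i q * v (x i))"
  proof (rule sum.cong)
    fix i
    have "v (x i + (\<lambda>p. - x i q)) = v (x i)"
      unfolding tangent_space_add[OF v x smooth_functions_const] tangent_space_const[OF v] by simp
    then show "v ((x i + (\<lambda>p. - x i q)) * g i) = g i q * v (x i)"
      unfolding tangent_space_mult[OF v smooth_functions_add[OF x smooth_functions_const] g] by simp
  qed simp
  also have "\<dots> = (\<Sum>i\<in>UNIV. v (x i) * frechet_derivative (f \<circ> inv_into U \<phi>) (at (\<phi> q)) (?e i))"
  proof -
    have "(F has_derivative frechet_derivative F (at (\<phi> q))) (at (\<phi> q))"
      using smooth_on_has_derivative[OF \<open>smooth_on UNIV F\<close>] by simp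
    moreover have "open (\<phi> ` (U \<inter> N))" by (rule open_chart_image[OF U N(1)])
    moreover have "F y = (f \<circ> inv_into U \<phi>) y" if "y \<in> \<phi> ` (U \<inter> N)" for y
      using that F_eq inv by auto
    ultimately have "((f \<circ> inv_into U \<phi>) has_derivative frechet_derivative F (at (\<phi> q))) (at (\<phi> q))"
      using q N(2)
      by (elim has_derivative_transform_within_open[where s = "\<phi> ` (U \<inter> N)"]) blast+
    from frechet_derivative_at[OF this] show ?thesis
      using N(3)[OF q] by (simp add: g_def G(3) mult.commute)
  qed
  finally show ?thesis by (simp add: x_def)
qed

text \<open>The coordinate field of the chart, cut off by \<open>b\<close>. Outside the chart domain
  the derivative is meaningless, but there the factor \<open>b q\<close> is zero when
  \<open>b\<close> comes from \<open>chart_bump\<close>; the value 0 on non-smooth \<open>f\<close>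
  is the convention of \<open>tangent_space\<close>.\<close>

definition coord_field :: "'m set \<Rightarrow> ('m \<Rightarrow> real^'n) \<Rightarrow> ('m \<Rightarrow> real) \<Rightarrow> 'n \<Rightarrow> 'm field"
  where "coord_field U \<phi> b i = (\<lambda>q f. if f \<in> smooth_functions A
    then b q * frechet_derivative (f \<circ> inv_into U \<phi>) (at (\<phi> q)) (axis i 1) else 0)"

lemma vector_field_coord_field:
  assumes b: "chart_bump U \<phi> N K b"
  shows "vector_field A (coord_field U \<phi> b i)"
proof -
  have U: "(U, \<phi>) \<in> A" and K: "\<And>p. p \<notin> U \<Longrightarrow> b p = 0"
    using b by (auto simp: chart_bump_def)
  have openU: "open (\<phi> ` U)" using open_chart_image[OF U open_UNIV] by simp
  have sm: "smooth_on (\<phi> ` U) (f \<circ> inv_into U \<phi>)" if "f \<in> smooth_functions A" for f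
    using that U by (auto simp: smooth_functions_def)
  have der: "((f \<circ> inv_into U \<phi>) has_derivative frechet_derivative (f \<circ> inv_into U \<phi>) (at (\<phi> q))) (at (\<phi> q))"
    if "f \<in> smooth_functions A" "q \<in> U" for f q
    using smooth_on_has_derivative[OF sm[OF that(1)]] that by simp
  have "coord_field U \<phi> b i q \<in> tangent_space A q" for q
  proof (cases "q \<in> U")
    case False
    then show ?thesis by (simp add: coord_field_def tangent_space_def K)
  next
    case True
    have "frechet_derivative ((f + h) \<circ> inv_into U \<phi>) (at (\<phi> q)) w =
        frechet_derivative (f \<circ> inv_into U \<phi>) (at (\<phi> q)) w + frechet_derivative (h \<circ> inv_into U \<phi>) (at (\<phi> q)) w"
      if "f \<in> smooth_functions A" "h \<in> smooth_functions A" for f h w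
      using frechet_derivative_at[OF has_derivative_add[OF der[OF that(1) True] der[OF that(2) True]], symmetric]
      by (simp add: o_def plus_fun_def)
    moreover have "frechet_derivative ((f * h) \<circ> inv_into U \<phi>) (at (\<phi> q)) w =
        f q * frechet_derivative (h \<circ> inv_into U \<phi>) (at (\<phi> q)) w + frechet_derivative (f \<circ> inv_into U \<phi>) (at (\<phi> q)) w * h q"
      if "f \<in> smooth_functions A" "h \<in> smooth_functions A" for f h w
      using frechet_derivative_at[OF has_derivative_mult[OF der[OF that(1) True] der[OF that(2) True]], symmetric]
      by (simp add: o_def times_fun_def inv_chart[OF U True])
    moreover have "frechet_derivative ((c *\<^sub>R f) \<circ> inv_into U \<phi>) (at (\<phi> q)) w =
        c * frechet_derivative (f \<circ> inv_into U \<phi>) (at (\<phi> q)) w"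
      if "f \<in> smooth_functions A" for f c w
      using frechet_derivative_at[OF has_derivative_mult_right[OF der[OF that True]], symmetric]
      by (simp add: o_def scaleR_fun_def)
    ultimately show ?thesis
      by (simp add: tangent_space_def coord_field_def smooth_functions_add smooth_functions_mult
          smooth_functions_scaleR algebra_simps)
  qed
  moreover have "app_field (coord_field U \<phi> b i) f \<in> smooth_functions A" if "f \<in> smooth_functions A" for f
    using smooth_functions_mult_bump[OF b smooth_fun_on_chart[OF U
          smooth_on_frechet_derivative[OF sm[OF that]]]] that
    by (simp add: app_field_def coord_field_def)
  ultimately show ?thesis by (simp add: vector_field_def)
qed

text \<open>On \<open>N\<close> the bump function is 1, so the cut-off coordinates and coordinate
  fields are the true ones: they are dual to each other, which gives linear independence, and the
  expansion is \<open>derivation_coordinates\<close>. Fields and functions are global; only these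
  two identities are restricted to \<open>N\<close>.\<close>

lemma local_frame:
  obtains N and E :: "'n \<Rightarrow> 'm field" and x :: "'n \<Rightarrow> 'm \<Rightarrow> real"
  where "open N" "p \<in> N" "\<And>i. vector_field A (E i)"
    "\<And>q i j. q \<in> N \<Longrightarrow> E i q (x j) = (if i = j then 1 else 0)"
    "\<And>q v. q \<in> N \<Longrightarrow> v \<in> tangent_space A q \<Longrightarrow> v = (\<Sum>i\<in>UNIV. v (x i) *\<^sub>R E i q)"
proof -
  obtain U \<phi> where U: "(U, \<phi>) \<in> A" "p \<in> U" by (rule chart_at)
  obtain N K b where b: "chart_bump U \<phi> N K b" "p \<in> N" "K \<subseteq> UNIV"
    using ex_chart_bump[OF U open_UNIV UNIV_I] .
  have openU: "open (\<phi> ` U)" using open_chart_image[OF U(1) open_UNIV] by simp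
  have N: "open N" "N \<subseteq> U" "\<And>p. p \<in> N \<Longrightarrow> b p = 1"
    using b by (auto simp: chart_bump_def)
  define x where "x = (\<lambda>i p. b p * \<phi> p $ i)"
  have x: "x i \<in> smooth_functions A" for i
    unfolding x_def
    by (intro smooth_functions_mult_bump[OF b(1)] smooth_fun_on_chart[OF U(1)] openU
        smooth_on_linear[OF bounded_linear_vec_nth] smooth_on_id)
  show ?thesis
  proof
    show "open N" "p \<in> N" by fact+
    show "vector_field A (coord_field U \<phi> b i)" for i
      by (rule vector_field_coord_field[OF b(1)])
    show "coord_field U \<phi> b i q (x j) = (if i = j then 1 else 0)" if "q \<in> N" for q i j
    proof -
      have "((\<lambda>y. y $ j) has_derivative (\<lambda>y. y $ j)) (at (\<phi> q))"
        by (intro bounded_linear_imp_has_derivative bounded_linear_vec_nth)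
      then have "((x j \<circ> inv_into U \<phi>) has_derivative (\<lambda>y. y $ j)) (at (\<phi> q))"
        using open_chart_image[OF U(1) N(1)] that N inv_chart[OF U(1)]
        by (elim has_derivative_transform_within_open[where s = "\<phi> ` (U \<inter> N)"]) (auto simp: x_def)
      from frechet_derivative_at[OF this, symmetric] show ?thesis
        using x N(3)[OF that] by (auto simp: coord_field_def axis_def)
    qed
    show "v = (\<Sum>i\<in>UNIV. v (x i) *\<^sub>R coord_field U \<phi> b i q)"
      if "q \<in> N" "v \<in> tangent_space A q" for q v
    proof
      fix f
      show "v f = (\<Sum>i\<in>UNIV. v (x i) *\<^sub>R coord_field U \<phi> b i q) f"
      proof (cases "f \<in> smooth_functions A")
        case True
        then show ?thesis
          using derivation_coordinates[OF b(1) that True] N(3)[OF that(1)]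
          by (simp add: sum_fun_apply scaleR_fun_def coord_field_def x_def)
      next
        case False
        then show ?thesis
          using that by (simp add: sum_fun_apply scaleR_fun_def coord_field_def tangent_space_def)
      qed
    qed
  qed
qed


section \<open>Operations on vector fields and extension of tangent vectors\<close>

lemma vector_field_tangent: "vector_field A X \<Longrightarrow> X p \<in> tangent_space A p"
  by (simp add: vector_field_def)

lemma vector_field_add:
  assumes "vector_field A X" "vector_field A Y"
  shows "vector_field A (X + Y)"
proof -
  have "app_field (X + Y) f = app_field X f + app_field Y f" for f
    by (simp add: app_field_def fun_eq_iff)
  then show ?thesis
    using assms
    by (simp add: vector_field_def subspace_add[OF tangent_space_subspace] smooth_functions_add)
qed

lemma vector_field_scale_field:
  assumes "f \<in> smooth_functions A" "vector_field A X"
  shows "vector_field A (scale_field f X)"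
proof -
  have "app_field (scale_field f X) h = f * app_field X h" for h
    by (simp add: app_field_def scale_field_def scaleR_fun_def fun_eq_iff)
  then show ?thesis
    using assms by (simp add: vector_field_def subspace_scale[OF tangent_space_subspace]
        smooth_functions_mult) (simp add: scale_field_def subspace_scale[OF tangent_space_subspace])
qed

lemma vector_field_diff:
  assumes "vector_field A X" "vector_field A Y"
  shows "vector_field A (X - Y)"
proof -
  have "X - Y = X + scale_field (\<lambda>p. - 1) Y"
    by (simp add: scale_field_def scaleR_fun_def fun_eq_iff)
  then show ?thesis
    using vector_field_add[OF assms(1) vector_field_scale_field[OF smooth_functions_const assms(2)]]
    by metis
qed

lemma vector_field_sum_const:
  assumes "finite I" "\<And>i. i \<in> I \<Longrightarrow> vector_field A (E i)"
  shows "vector_field A (\<lambda>p. \<Sum>i\<in>I. c i *\<^sub>R E i p)"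
  using assms
proof (induction I)
  case empty
  have "vector_field A (\<lambda>p. 0)"
    using subspace_0[OF tangent_space_subspace] smooth_functions_const[of 0]
    by (simp add: vector_field_def app_field_def)
  then show ?case unfolding sum.empty .
next
  case (insert i I)
  have "(\<lambda>p. \<Sum>j\<in>insert i I. c j *\<^sub>R E j p) = scale_field (\<lambda>p. c i) (E i) + (\<lambda>p. \<Sum>j\<in>I. c j *\<^sub>R E j p)"
    unfolding sum.insert[OF insert.hyps] by (simp add: scale_field_def plus_fun_def)
  moreover have "vector_field A (scale_field (\<lambda>p. c i) (E i))"
    by (intro vector_field_scale_field smooth_functions_const insert.prems) simp
  moreover have "vector_field A (\<lambda>p. \<Sum>j\<in>I. c j *\<^sub>R E j p)"
    by (intro insert.IH insert.prems) simp
  ultimately show ?case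
    by (simp only: vector_field_add)
qed

text \<open>The frame fields are already global, so the combination whose constant coefficients are
  the components of \<open>v\<close> will do. This makes the choice inside \<open>value_at\<close> a
  genuine extension.\<close>

lemma vector_field_extension:
  assumes "v \<in> tangent_space A p"
  shows "\<exists>X. vector_field A X \<and> X p = v"
proof -
  obtain N and E :: "'n \<Rightarrow> 'm field" and x :: "'n \<Rightarrow> 'm \<Rightarrow> real" where
    E: "p \<in> N" "\<And>i. vector_field A (E i)"
    "\<And>q v. q \<in> N \<Longrightarrow> v \<in> tangent_space A q \<Longrightarrow> v = (\<Sum>i\<in>UNIV. v (x i) *\<^sub>R E i q)"
    by (rule local_frame[of p]) blast
  show ?thesis
  proof (intro exI conjI)
    show "vector_field A (\<lambda>q. \<Sum>i\<in>UNIV. v (x i) *\<^sub>R E i q)"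
      by (intro vector_field_sum_const E(2) finite)
    show "(\<Sum>i\<in>UNIV. v (x i) *\<^sub>R E i p) = v"
      using E(3)[OF E(1) assms] by (rule sym)
  qed
qed

text \<open>Provides finiteness of the bases used for traces: a sum over an infinite set would be 0
  by convention.\<close>

lemma finite_spanning_set: "\<exists>S. finite S \<and> span S = tangent_space A p"
proof -
  obtain N and E :: "'n \<Rightarrow> 'm field" and x :: "'n \<Rightarrow> 'm \<Rightarrow> real" where
    E: "p \<in> N" "\<And>i. vector_field A (E i)"
    "\<And>q v. q \<in> N \<Longrightarrow> v \<in> tangent_space A q \<Longrightarrow> v = (\<Sum>i\<in>UNIV. v (x i) *\<^sub>R E i q)"
    by (rule local_frame[of p]) blast
  have "v \<in> span (range (\<lambda>i. E i p))" if "v \<in> tangent_space A p" for v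
    by (subst E(3)[OF E(1) that]) (intro span_sum span_scale span_base rangeI)
  moreover have "span (range (\<lambda>i. E i p)) \<subseteq> tangent_space A p"
    using vector_field_tangent[OF E(2)] by (intro span_minimal tangent_space_subspace) auto
  ultimately show ?thesis
    by (intro exI[of _ "range (\<lambda>i. E i p)"]) auto
qed

end

section \<open>Riemannian metrics and raising the index of a one-form\<close>

locale riemannian_manifold = manifold A
  for A :: "('m::{t2_space,second_countable_topology}, 'n::finite) chart set" +
  fixes g :: "'m form2"
  assumes metric: "riemannian_metric A g"
begin

lemma
  assumes "u \<in> tangent_space A p" "v \<in> tangent_space A p"
  shows metric_sym: "g p u v = g p v u"
    and metric_scale_left: "g p (c *\<^sub>R u) v = c * g p u v"
    and metric_pos: "u \<noteq> 0 \<Longrightarrow> g p u u > 0"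
  using metric assms unfolding riemannian_metric_def by blast+

lemma metric_add_left:
  assumes "u \<in> tangent_space A p" "v \<in> tangent_space A p" "w \<in> tangent_space A p"
  shows "g p (u + v) w = g p u w + g p v w"
  using metric assms unfolding riemannian_metric_def by blast

text \<open>\<open>g p\<close> is linear only on the tangent space, which is a proper part of its
  argument type in general; the induction therefore carries the membership of the partial
  sums.\<close>

lemma metric_sum_left:
  assumes "\<And>i. i \<in> I \<Longrightarrow> u i \<in> tangent_space A p" "w \<in> tangent_space A p"
  shows "g p (\<Sum>i\<in>I. c i *\<^sub>R u i) w = (\<Sum>i\<in>I. c i * g p (u i) w)"
proof -
  note T = tangent_space_subspace
  have zero: "g p 0 w = 0"
    using metric_scale_left[OF subspace_0[OF T] assms(2), of 0] by simp
  show ?thesis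
    using assms(1)
  proof (induction I rule: infinite_finite_induct)
    case (insert i I)
    have s: "(\<Sum>j\<in>I. c j *\<^sub>R u j) \<in> tangent_space A p"
      using insert.prems by (intro subspace_sum[OF T] subspace_scale[OF T]) auto
    have ui: "u i \<in> tangent_space A p" using insert.prems by simp
    show ?case
      unfolding sum.insert[OF insert.hyps] metric_add_left[OF subspace_scale[OF T ui] s assms(2)]
        metric_scale_left[OF ui assms(2)] using insert.IH insert.prems by simp
  qed (simp_all add: zero)
qed

lemma metric_nondegenerate:
  assumes "u \<in> tangent_space A p" "\<And>v. v \<in> tangent_space A p \<Longrightarrow> g p u v = 0"
  shows "u = 0"
  using metric_pos[OF assms(1) assms(1)] assms(2)[OF assms(1)] by fastforce

lemma metric_eqI:
  assumes u: "u \<in> tangent_space A p" and u': "u' \<in> tangent_space A p"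
    and eq: "\<And>v. v \<in> tangent_space A p \<Longrightarrow> g p u v = g p u' v"
  shows "u = u'"
proof -
  note T = tangent_space_subspace
  have "g p (u + (- 1) *\<^sub>R u') v = 0" if "v \<in> tangent_space A p" for v
    unfolding metric_add_left[OF u subspace_scale[OF T u'] that] metric_scale_left[OF u' that] eq[OF that]
    by simp
  then have "u + (- 1) *\<^sub>R u' = 0"
    using u u' by (intro metric_nondegenerate subspace_add[OF T] subspace_scale[OF T])
  then show ?thesis by simp
qed

lemma one_form_sum:
  assumes "one_form A \<omega>" "\<And>i. i \<in> I \<Longrightarrow> u i \<in> tangent_space A p"
  shows "\<omega> p (\<Sum>i\<in>I. c i *\<^sub>R u i) = (\<Sum>i\<in>I. c i * \<omega> p (u i))"
proof -
  note T = tangent_space_subspace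
  have add: "\<omega> p (v + w) = \<omega> p v + \<omega> p w"
    if "v \<in> tangent_space A p" "w \<in> tangent_space A p" for v w
    using assms(1) that by (auto simp: one_form_def)
  have scale: "\<omega> p (a *\<^sub>R v) = a * \<omega> p v" if "v \<in> tangent_space A p" for v a
    using assms(1) that by (auto simp: one_form_def)
  have zero: "\<omega> p 0 = 0" using scale[OF subspace_0[OF T], of 0] by simp
  show ?thesis
    using assms(2)
  proof (induction I rule: infinite_finite_induct)
    case (insert i I)
    have s: "(\<Sum>j\<in>I. c j *\<^sub>R u j) \<in> tangent_space A p"
      using insert.prems by (intro subspace_sum[OF T] subspace_scale[OF T]) auto
    have ui: "u i \<in> tangent_space A p" using insert.prems by simp
    show ?case
      unfolding sum.insert[OF insert.hyps] add[OF subspace_scale[OF T ui] s] scale[OF ui]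
      using insert.IH insert.prems by simp
  qed (simp_all add: zero)
qed

text \<open>In a local frame the components of the dual field solve a linear system with the Gram
  matrix; Cramer's rule shows that they are smooth.\<close>

lemma local_sharp:
  assumes \<omega>: "one_form A \<omega>"
  obtains N and E :: "'n \<Rightarrow> 'm field" and c :: "'n \<Rightarrow> 'm \<Rightarrow> real"
  where "open N" "p \<in> N" "\<And>i. vector_field A (E i)" "\<And>i. smooth_fun_on A N (c i)"
    "\<And>q v. q \<in> N \<Longrightarrow> v \<in> tangent_space A q \<Longrightarrow> g q (\<Sum>i\<in>UNIV. c i q *\<^sub>R E i q) v = \<omega> q v"
proof -
  obtain N and E :: "'n \<Rightarrow> 'm field" and x :: "'n \<Rightarrow> 'm \<Rightarrow> real" where
    N: "open N" "p \<in> N" and E: "\<And>i. vector_field A (E i)"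
    and dual: "\<And>q i j. q \<in> N \<Longrightarrow> E i q (x j) = (if i = j then 1 else 0)"
    and expand: "\<And>q v. q \<in> N \<Longrightarrow> v \<in> tangent_space A q \<Longrightarrow> v = (\<Sum>i\<in>UNIV. v (x i) *\<^sub>R E i q)"
    by (rule local_frame[of p]) blast
  note ET = vector_field_tangent[OF E]
  define M :: "'m \<Rightarrow> real^'n^'n" where "M = (\<lambda>q. \<chi> i j. g q (E j q) (E i q))"
  define b :: "'m \<Rightarrow> real^'n" where "b = (\<lambda>q. \<chi> i. \<omega> q (E i q))"
  define M' :: "'n \<Rightarrow> 'm \<Rightarrow> real^'n^'n"
    where "M' = (\<lambda>k q. \<chi> i j. if j = k then b q $ i else M q $ i $ j)"
  define c where "c = (\<lambda>k q. det (M' k q) * inverse (det (M q)))"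
  have M_mult: "(M q *v y) $ i = g q (\<Sum>j\<in>UNIV. y $ j *\<^sub>R E j q) (E i q)" for q y i
    by (simp add: matrix_vector_mult_def M_def metric_sum_left[OF ET ET] mult.commute)
  have all: "g q u v = \<omega> q v"
    if q: "q \<in> N" and u: "u \<in> tangent_space A q" and v: "v \<in> tangent_space A q"
      and eq: "\<And>i. g q u (E i q) = \<omega> q (E i q)" for q u v
  proof -
    have "g q u v = g q v u" by (rule metric_sym[OF u v])
    also have "\<dots> = g q (\<Sum>i\<in>UNIV. v (x i) *\<^sub>R E i q) u" using expand[OF q v] by simp
    also have "\<dots> = (\<Sum>i\<in>UNIV. v (x i) * \<omega> q (E i q))"
      unfolding metric_sum_left[OF ET u] metric_sym[OF ET u] eq ..
    also have "\<dots> = \<omega> q v"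
      using expand[OF q v, symmetric]
        one_form_sum[where u = "\<lambda>i. E i q" and I = UNIV and c = "\<lambda>i. v (x i)", OF \<omega> ET] by simp
    finally show ?thesis .
  qed
  have sum_tangent: "(\<Sum>j\<in>UNIV. y j *\<^sub>R E j q) \<in> tangent_space A q" for y q
    by (intro subspace_sum[OF tangent_space_subspace] subspace_scale[OF tangent_space_subspace] ET)
  \<comment> \<open>A vector in the kernel of the Gram matrix is the component vector of a tangent
    vector orthogonal to the frame, hence to itself, hence zero; the functions \<open>x i\<close>
    dual to the frame read off its components.\<close>
  have det: "det (M q) \<noteq> 0" if q: "q \<in> N" for q
  proof -
    have "y = 0" if y: "M q *v y = 0" for y
    proof -
      define u where "u = (\<Sum>j\<in>UNIV. y $ j *\<^sub>R E j q)"
      have u: "u \<in> tangent_space A q" unfolding u_def by (rule sum_tangent)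
      have "g q u (E i q) = 0" for i
        using M_mult[of q y i] y by (simp add: u_def)
      then have "g q (E i q) u = 0" for i
        using metric_sym[OF u ET] by simp
      then have "g q u u = 0"
        using metric_sum_left[where u = "\<lambda>i. E i q" and I = UNIV and c = "\<lambda>i. u (x i)", OF ET u]
          expand[OF q u, symmetric] by simp
      then have "u = 0" using metric_pos[OF u u] by fastforce
      moreover have "u (x i) = y $ i" for i
        by (simp add: u_def sum_fun_apply scaleR_fun_def dual[OF q] if_distrib cong: if_cong)
      ultimately show "y = 0" by (simp add: vec_eq_iff)
    qed
    then show ?thesis
      using invertible_det_nz[of "M q"] invertible_left_inverse[of "M q"]
        matrix_left_invertible_ker[of "M q"] by blast
  qed
  have smooth_M: "smooth_fun_on A N (\<lambda>q. M q $ i $ j)" for i j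
  proof -
    have "app_metric g (E j) (E i) \<in> smooth_functions A"
      using metric E unfolding riemannian_metric_def by blast
    from smooth_functions_imp_smooth_fun_on[OF this] show ?thesis
      by (simp add: M_def app_metric_def)
  qed
  have smooth_b: "smooth_fun_on A N (\<lambda>q. b q $ i)" for i
  proof -
    have "app_form \<omega> (E i) \<in> smooth_functions A"
      using \<omega> E unfolding one_form_def by blast
    from smooth_functions_imp_smooth_fun_on[OF this] show ?thesis
      by (simp add: b_def app_form_def)
  qed
  have smooth_M': "smooth_fun_on A N (\<lambda>q. M' k q $ i $ j)" for i j k
    using smooth_M smooth_b by (cases "j = k") (simp_all add: M'_def)
  have smooth_c: "smooth_fun_on A N (c k)" for k
    unfolding c_def
    by (rule smooth_fun_on_mult[OF N(1) smooth_fun_on_det[OF N(1) smooth_M']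
          smooth_fun_on_inverse[OF N(1) smooth_fun_on_det[OF N(1) smooth_M] det]])
  show ?thesis
  proof
    fix q v assume q: "q \<in> N" and v: "v \<in> tangent_space A q"
    have "(\<chi> k. c k q) = (\<chi> k. det (\<chi> i j. if j = k then b q $ i else M q $ i $ j) / det (M q))"
      by (simp add: c_def M'_def divide_inverse)
    then have "M q *v (\<chi> k. c k q) = b q"
      by (rule iffD2[OF cramer[OF det[OF q]]])
    then have "g q (\<Sum>i\<in>UNIV. c i q *\<^sub>R E i q) (E i q) = \<omega> q (E i q)" for i
      using M_mult[of q "\<chi> k. c k q" i] by (simp add: b_def)
    then show "g q (\<Sum>i\<in>UNIV. c i q *\<^sub>R E i q) v = \<omega> q v"
      by (rule all[OF q sum_tangent v])
  qed (use N E smooth_c in auto)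
qed

text \<open>The solution is unique at each point by positivity of the metric, so a field chosen
  point by point coincides near every point with a smooth local solution. No gluing by a partition
  of unity is involved.\<close>

lemma ex_sharp:
  assumes \<omega>: "one_form A \<omega>"
  shows "\<exists>U. vector_field A U \<and> (\<forall>p. \<forall>v\<in>tangent_space A p. g p (U p) v = \<omega> p v)"
proof -
  define S where "S = (\<lambda>p u. u \<in> tangent_space A p \<and> (\<forall>v\<in>tangent_space A p. g p u v = \<omega> p v))"
  define U where "U = (\<lambda>p. SOME u. S p u)"
  have unique: "u = u'" if "S p u" "S p u'" for p u u'
    using that unfolding S_def by (intro metric_eqI[of u p]) auto
  have local: "\<exists>N. open N \<and> p \<in> N \<and> (\<forall>q\<in>N. S q (U q)) \<and>
      (\<forall>f\<in>smooth_functions A. smooth_fun_on A N (app_field U f))" for p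
  proof -
    obtain N and E :: "'n \<Rightarrow> 'm field" and c where
      N: "open N" "p \<in> N" and E: "\<And>i. vector_field A (E i)"
      and c: "\<And>i. smooth_fun_on A N (c i)"
      and eq: "\<And>q v. q \<in> N \<Longrightarrow> v \<in> tangent_space A q \<Longrightarrow> g q (\<Sum>i\<in>UNIV. c i q *\<^sub>R E i q) v = \<omega> q v"
      by (rule local_sharp[OF \<omega>, of p]) blast
    have S: "S q (\<Sum>i\<in>UNIV. c i q *\<^sub>R E i q)" if "q \<in> N" for q
      using eq[OF that] unfolding S_def
      by (auto intro!: subspace_sum[OF tangent_space_subspace] subspace_scale[OF tangent_space_subspace]
          vector_field_tangent[OF E])
    have SU: "S q (U q)" if "q \<in> N" for q
      unfolding U_def by (rule someI[of "S q", OF S[OF that]])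
    have U_eq: "(\<Sum>i\<in>UNIV. c i q * app_field (E i) f q) = app_field U f q" if "q \<in> N" for q f
      using unique[OF SU[OF that] S[OF that]] by (simp add: app_field_def sum_fun_apply scaleR_fun_def)
    have "smooth_fun_on A N (app_field U f)" if "f \<in> smooth_functions A" for f
    proof (rule smooth_fun_on_cong[OF N(1)])
      show "smooth_fun_on A N (\<lambda>q. \<Sum>i\<in>UNIV. c i q * app_field (E i) f q)"
        using E that by (intro smooth_fun_on_sum smooth_fun_on_mult N(1) c
            smooth_functions_imp_smooth_fun_on) (auto simp: vector_field_def)
    qed (rule U_eq)
    then show ?thesis using N SU by blast
  qed
  have "S p (U p)" for p using local by blast
  moreover have "app_field U f \<in> smooth_functions A" if "f \<in> smooth_functions A" for f
    unfolding smooth_functions_iff by (rule smooth_fun_on_Union) (use local that in blast)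
  ultimately show ?thesis
    by (intro exI[of _ U]) (auto simp: vector_field_def S_def)
qed

end

section \<open>The conjugate curvature\<close>

locale recurrent_statistical_manifold = riemannian_manifold A g
  for A :: "('m::{t2_space,second_countable_topology}, 'n::finite) chart set" and g :: "'m form2" +
  fixes nabla :: "'m connection" and \<omega> :: "'m form1"
  assumes connection: "affine_connection A nabla" and torsion_free: "torsion_free A nabla"
    and one_form: "one_form A \<omega>" and closed: "closed_form A \<omega>"
    and recurrent: "\<And>X Y Z. vector_field A X \<Longrightarrow> vector_field A Y \<Longrightarrow> vector_field A Z \<Longrightarrow>
      nabla_metric g nabla Y Z X =
        app_form \<omega> X * app_metric g Y Z + app_form \<omega> Y * app_metric g Z X
          + app_form \<omega> Z * app_metric g X Y"
begin

section \<open>The metric and the form evaluated on vector fields\<close>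

abbreviation "vf \<equiv> vector_field A"

definition sharp :: "'m field"
  where "sharp = (SOME U. vector_field A U \<and> (\<forall>p. \<forall>v\<in>tangent_space A p. g p (U p) v = \<omega> p v))"

lemma vf_sharp: "vf sharp" and metric_sharp: "v \<in> tangent_space A p \<Longrightarrow> g p (sharp p) v = \<omega> p v"
  using someI_ex[OF ex_sharp[OF one_form]] by (auto simp: sharp_def)

lemma smooth_metric: "vf X \<Longrightarrow> vf Y \<Longrightarrow> app_metric g X Y \<in> smooth_functions A"
  using metric by (auto simp: riemannian_metric_def)

lemma smooth_form: "vf X \<Longrightarrow> app_form \<omega> X \<in> smooth_functions A"
  using one_form by (auto simp: one_form_def)

lemma vf_nabla: "vf X \<Longrightarrow> vf Y \<Longrightarrow> vf (nabla X Y)"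
  using connection by (auto simp: affine_connection_def)

lemma bracket_eq: "vf X \<Longrightarrow> vf Y \<Longrightarrow> lie_bracket A X Y = nabla X Y - nabla Y X"
  using torsion_free by (auto simp: torsion_free_def)

lemma app_metric_sym: "vf X \<Longrightarrow> vf Y \<Longrightarrow> app_metric g X Y = app_metric g Y X"
  by (auto simp: app_metric_def fun_eq_iff vector_field_tangent intro: metric_sym)

lemma app_metric_add_left:
  "vf X \<Longrightarrow> vf Y \<Longrightarrow> vf Z \<Longrightarrow> app_metric g (X + Y) Z = app_metric g X Z + app_metric g Y Z"
  by (simp add: app_metric_def fun_eq_iff vector_field_tangent metric_add_left)

lemma app_metric_scale_left:
  "vf X \<Longrightarrow> vf Z \<Longrightarrow> app_metric g (scale_field f X) Z = f * app_metric g X Z"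
  by (simp add: app_metric_def fun_eq_iff vector_field_tangent scale_field_def metric_scale_left)

lemma app_metric_add_right:
  "vf X \<Longrightarrow> vf Y \<Longrightarrow> vf Z \<Longrightarrow> app_metric g Z (X + Y) = app_metric g Z X + app_metric g Z Y"
  using app_metric_add_left[of X Y Z] app_metric_sym[of Z "X + Y"] app_metric_sym[of Z X]
    app_metric_sym[of Z Y] by (simp add: vector_field_add)

lemma app_metric_scale_right:
  "f \<in> smooth_functions A \<Longrightarrow> vf X \<Longrightarrow> vf Z \<Longrightarrow> app_metric g Z (scale_field f X) = f * app_metric g Z X"
  using app_metric_scale_left[of X Z f] app_metric_sym[of Z "scale_field f X"] app_metric_sym[of Z X]
  by (simp add: vector_field_scale_field)

lemma app_metric_diff_left:
  assumes "vf X" "vf Y" "vf Z"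
  shows "app_metric g (X - Y) Z = app_metric g X Z - app_metric g Y Z"
proof -
  have "app_metric g (X - Y + Y) Z = app_metric g (X - Y) Z + app_metric g Y Z"
    by (intro app_metric_add_left vector_field_diff assms)
  then show ?thesis by simp
qed

lemma app_form_add: "vf X \<Longrightarrow> vf Y \<Longrightarrow> app_form \<omega> (X + Y) = app_form \<omega> X + app_form \<omega> Y"
  using one_form by (simp add: app_form_def fun_eq_iff one_form_def vector_field_tangent)

lemma app_form_scale: "vf X \<Longrightarrow> app_form \<omega> (scale_field f X) = f * app_form \<omega> X"
  using one_form by (simp add: app_form_def fun_eq_iff one_form_def vector_field_tangent scale_field_def)

lemma app_form_diff:
  assumes "vf X" "vf Y"
  shows "app_form \<omega> (X - Y) = app_form \<omega> X - app_form \<omega> Y"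
proof -
  have "app_form \<omega> (X - Y + Y) = app_form \<omega> (X - Y) + app_form \<omega> Y"
    by (intro app_form_add vector_field_diff assms)
  then show ?thesis by simp
qed

lemma app_metric_sharp: "vf X \<Longrightarrow> app_metric g sharp X = app_form \<omega> X"
  by (simp add: app_metric_def app_form_def metric_sharp vector_field_tangent)

lemma app_metric_sharp_right: "vf X \<Longrightarrow> app_metric g X sharp = app_form \<omega> X"
  using app_metric_sharp app_metric_sym[OF vf_sharp] by simp

section \<open>The conjugate connection in closed form\<close>

lemma deriv_metric:
  assumes "vf X" "vf Y" "vf Z"
  shows "app_field X (app_metric g Y Z) = app_metric g (nabla X Y) Z + app_metric g Y (nabla X Z) +
    app_form \<omega> X * app_metric g Y Z + app_form \<omega> Y * app_metric g X Z + app_form \<omega> Z * app_metric g X Y"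
  using recurrent[OF assms] app_metric_sym[OF assms(3,1)]
  by (simp add: nabla_metric_def fun_eq_iff algebra_simps)

text \<open>Obtained by inserting \<open>deriv_metric\<close> into the duality equation and reading
  the remaining terms as a pairing with Y. The term \<omega>(Y) g(X,Z) is the pairing of Y with
  g(X,Z) times \<open>sharp\<close>; this is where the dual field comes in.\<close>

definition dual :: "'m connection"
  where "dual X Z = nabla X Z + scale_field (app_form \<omega> X) Z + scale_field (app_form \<omega> Z) X
    + scale_field (app_metric g X Z) sharp"

lemma vf_dual: "vf X \<Longrightarrow> vf Z \<Longrightarrow> vf (dual X Z)"
  unfolding dual_def
  by (intro vector_field_add vector_field_scale_field vf_nabla smooth_form smooth_metric vf_sharp)

lemmas vf_intros = vector_field_add vector_field_diff vector_field_scale_field vf_nabla smooth_form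
  smooth_metric vf_sharp vf_dual

lemma app_metric_dual:
  assumes "vf X" "vf Y" "vf Z"
  shows "app_metric g Y (dual X Z) = app_metric g Y (nabla X Z) + app_form \<omega> X * app_metric g Y Z
    + app_form \<omega> Z * app_metric g X Y + app_metric g X Z * app_form \<omega> Y"
  unfolding dual_def
  by (simp add: assms vf_intros app_metric_add_right app_metric_scale_right app_metric_sharp_right
      app_metric_sym[OF assms(2,1)])

text \<open>Testing with \<open>W - W'\<close> itself makes its squared length zero at every
  point.\<close>

lemma vector_field_eqI:
  assumes "vf W" "vf W'" "\<And>Y. vf Y \<Longrightarrow> app_metric g Y W = app_metric g Y W'"
  shows "W = W'"
proof
  fix p
  have "app_metric g (W - W') (W - W') = app_metric g W (W - W') - app_metric g W' (W - W')"
    using assms by (intro app_metric_diff_left vf_intros)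
  also have "\<dots> = 0"
    using assms(3)[OF vector_field_diff[OF assms(1,2)]] app_metric_sym[OF _ vector_field_diff[OF assms(1,2)]]
      assms(1,2) by simp
  finally have "g p ((W - W') p) ((W - W') p) = 0"
    by (simp add: app_metric_def fun_eq_iff)
  moreover have "(W - W') p \<in> tangent_space A p"
    by (intro vector_field_tangent vector_field_diff assms)
  ultimately have "(W - W') p = 0"
    using metric_pos by fastforce
  then show "W p = W' p" by simp
qed

text \<open>Eliminates the definite description in favour of a formula that can be differentiated.
  It holds for vector fields only, so later uses have to know that all arguments are such.\<close>

lemma dual_connection_eq:
  assumes X: "vf X" and Z: "vf Z"
  shows "dual_connection A g nabla X Z = dual X Z"
  unfolding dual_connection_def
proof (rule the_equality)
  have eq: "app_field X (app_metric g Y Z) = app_metric g (nabla X Y) Z + app_metric g Y (dual X Z)"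
    if Y: "vf Y" for Y
    unfolding deriv_metric[OF X Y Z] app_metric_dual[OF X Y Z] by (simp add: algebra_simps)
  then show "vf (dual X Z) \<and> (\<forall>Y. vf Y \<longrightarrow>
      app_field X (app_metric g Y Z) = app_metric g (nabla X Y) Z + app_metric g Y (dual X Z))"
    using vf_dual[OF X Z] by blast
  fix W
  assume W: "vf W \<and> (\<forall>Y. vf Y \<longrightarrow>
      app_field X (app_metric g Y Z) = app_metric g (nabla X Y) Z + app_metric g Y W)"
  show "W = dual X Z"
  proof (rule vector_field_eqI)
    show "app_metric g Y W = app_metric g Y (dual X Z)" if "vf Y" for Y
      using W eq[OF that] that by simp
  qed (use W vf_dual[OF X Z] in auto)
qed

text \<open>The tensor \<open>\<nabla>\<omega> - \<omega> \<otimes> \<omega>\<close> with one index raised; it is symmetric because \<open>\<omega>\<close> is closed.\<close>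

definition L :: "'m field \<Rightarrow> 'm field"
  where "L X = nabla X sharp + scale_field (app_form \<omega> X) sharp + scale_field (app_form \<omega> sharp) X"

lemma vf_L: "vf X \<Longrightarrow> vf (L X)"
  unfolding L_def by (intro vf_intros)

lemma app_metric_L:
  assumes "vf X" "vf Z"
  shows "app_metric g (L X) Z = app_metric g (nabla X sharp) Z + app_form \<omega> X * app_form \<omega> Z
    + app_form \<omega> sharp * app_metric g X Z"
  unfolding L_def
  by (simp add: assms vf_intros app_metric_add_left app_metric_scale_left app_metric_sharp)

text \<open>\<open>deriv_metric\<close> with \<open>sharp\<close> in the second place, since
  \<omega>(Z) is the pairing of \<open>sharp\<close> with Z. Two of the three recurrence terms
  become \<omega>(X) \<omega>(Z), hence the factor 2.\<close>

lemma deriv_form: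
  assumes "vf X" "vf Z"
  shows "app_field X (app_form \<omega> Z) = app_metric g (nabla X sharp) Z + app_form \<omega> (nabla X Z)
    + 2 * app_form \<omega> X * app_form \<omega> Z + app_form \<omega> sharp * app_metric g X Z"
  using deriv_metric[OF assms(1) vf_sharp assms(2)] assms
  by (simp add: app_metric_sharp app_metric_sharp_right vf_intros)

text \<open>Torsion-freeness trades the Lie bracket in the exterior derivative for covariant
  derivatives, the form in which the identity enters the computations.\<close>

lemma closed_eq:
  assumes "vf X" "vf Y"
  shows "app_field X (app_form \<omega> Y) - app_field Y (app_form \<omega> X) = app_form \<omega> (nabla X Y) - app_form \<omega> (nabla Y X)"
proof -
  have "exterior_derivative A \<omega> X Y = 0"
    using closed assms by (auto simp: closed_form_def)
  then show ?thesis
    unfolding exterior_derivative_def bracket_eq[OF assms]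
      app_form_diff[OF vf_nabla[OF assms] vf_nabla[OF assms(2,1)]] by simp
qed

text \<open>By \<open>deriv_form\<close>, g(LX,Y) is X(\<omega>(Y)) -
  \<omega>(\<open>nabla X Y\<close>) - \<omega>(X) \<omega>(Y), whose difference under exchange of X
  and Y is d\<omega>(X,Y).\<close>

lemma L_symmetric:
  assumes "vf X" "vf Y"
  shows "app_metric g (L X) Y = app_metric g (L Y) X"
  using closed_eq[OF assms] app_metric_sym[OF assms]
  unfolding deriv_form[OF assms] deriv_form[OF assms(2,1)] app_metric_L[OF assms] app_metric_L[OF assms(2,1)]
  by (simp add: algebra_simps)

section \<open>The curvature of the conjugate connection\<close>

lemma nabla_add_right: "vf X \<Longrightarrow> vf Y \<Longrightarrow> vf Z \<Longrightarrow> nabla X (Y + Z) = nabla X Y + nabla X Z"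
  using connection by (auto simp: affine_connection_def)

lemma nabla_scale_right:
  "f \<in> smooth_functions A \<Longrightarrow> vf X \<Longrightarrow> vf Y \<Longrightarrow>
    nabla X (scale_field f Y) = scale_field (app_field X f) Y + scale_field f (nabla X Y)"
  using connection by (auto simp: affine_connection_def)

lemma nabla_dual:
  assumes X: "vf X" and Y: "vf Y" and Z: "vf Z"
  shows "nabla X (dual Y Z) = nabla X (nabla Y Z)
    + (scale_field (app_field X (app_form \<omega> Y)) Z + scale_field (app_form \<omega> Y) (nabla X Z))
    + (scale_field (app_field X (app_form \<omega> Z)) Y + scale_field (app_form \<omega> Z) (nabla X Y))
    + (scale_field (app_field X (app_metric g Y Z)) sharp + scale_field (app_metric g Y Z) (nabla X sharp))"
  unfolding dual_def
  by (simp only: nabla_add_right nabla_scale_right assms vf_intros)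

lemma app_form_dual:
  assumes "vf Y" "vf Z"
  shows "app_form \<omega> (dual Y Z) = app_form \<omega> (nabla Y Z) + 2 * app_form \<omega> Y * app_form \<omega> Z
    + app_metric g Y Z * app_form \<omega> sharp"
  unfolding dual_def by (simp add: assms vf_intros app_form_add app_form_scale)

text \<open>Evaluated at a point and a function, the claim is an identity between real numbers. The
  product rules expose all derivatives of coefficients; those of g(Y,Z) and of \<omega>(Z) are
  rewritten through \<open>nabla\<close>, the bracket is removed by torsion-freeness, and the
  iterated \<open>nabla\<close> terms are the same on both sides. What is left is ring
  arithmetic.\<close>

lemma curvature_dual:
  assumes X: "vf X" and Y: "vf Y" and Z: "vf Z"
  shows "curvature A dual X Y Z = curvature A nabla X Y Z
    + (scale_field (app_metric g (L X) Z) Y - scale_field (app_metric g (L Y) Z) X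
      + scale_field (app_metric g Y Z) (L X) - scale_field (app_metric g X Z) (L Y))"
proof (intro ext)
  fix p f
  let ?B = "lie_bracket A X Y"
  have B: "vf ?B"
    unfolding bracket_eq[OF X Y] by (intro vf_intros X Y)
  have d: "dual V W p f = nabla V W p f + app_form \<omega> V p * W p f + app_form \<omega> W p * V p f
      + app_metric g V W p * sharp p f" for V W
    by (simp add: dual_def scale_field_def scaleR_fun_def)
  have nd: "nabla V (dual W Z) p f = nabla V (nabla W Z) p f
      + (app_field V (app_form \<omega> W) p * Z p f + app_form \<omega> W p * nabla V Z p f)
      + (app_field V (app_form \<omega> Z) p * W p f + app_form \<omega> Z p * nabla V W p f)
      + (app_field V (app_metric g W Z) p * sharp p f + app_metric g W Z p * nabla V sharp p f)"
    if "vf V" "vf W" for V W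
    unfolding nabla_dual[OF that Z] by (simp add: scale_field_def scaleR_fun_def)
  have fd: "app_form \<omega> (dual W Z) p = app_form \<omega> (nabla W Z) p + 2 * app_form \<omega> W p * app_form \<omega> Z p
      + app_metric g W Z p * app_form \<omega> sharp p" if "vf W" for W
    unfolding app_form_dual[OF that Z] by simp
  have md: "app_metric g V (dual W Z) p = app_metric g V (nabla W Z) p + app_form \<omega> W p * app_metric g V Z p
      + app_form \<omega> Z p * app_metric g W V p + app_metric g W Z p * app_form \<omega> V p"
    if "vf V" "vf W" for V W
    unfolding app_metric_dual[OF that(2,1) Z] by simp
  have dm: "app_field V (app_metric g W Z) p = app_metric g (nabla V W) Z p + app_metric g W (nabla V Z) p
      + app_form \<omega> V p * app_metric g W Z p + app_form \<omega> W p * app_metric g V Z p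
      + app_form \<omega> Z p * app_metric g V W p" if "vf V" "vf W" for V W
    unfolding deriv_metric[OF that Z] by simp
  have df: "app_field V (app_form \<omega> Z) p = app_metric g (nabla V sharp) Z p + app_form \<omega> (nabla V Z) p
      + 2 * app_form \<omega> V p * app_form \<omega> Z p + app_form \<omega> sharp p * app_metric g V Z p" if "vf V" for V
    unfolding deriv_form[OF that Z] by simp
  \<comment> \<open>This removes the component along Z: its coefficient is X(\<omega>(Y)) -
    Y(\<omega>(X)) - \<omega>([X,Y]).\<close>
  have cl: "app_field X (app_form \<omega> Y) p = app_field Y (app_form \<omega> X) p + app_form \<omega> (nabla X Y) p
      - app_form \<omega> (nabla Y X) p"
    using fun_cong[OF closed_eq[OF X Y], of p] by simp
  have br: "app_form \<omega> ?B p = app_form \<omega> (nabla X Y) p - app_form \<omega> (nabla Y X) p"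
    "app_metric g ?B Z p = app_metric g (nabla X Y) Z p - app_metric g (nabla Y X) Z p"
    "?B p f = nabla X Y p f - nabla Y X p f"
    unfolding bracket_eq[OF X Y]
    by (simp_all add: app_form_diff app_metric_diff_left vf_nabla X Y Z)
  have mL: "app_metric g (L V) Z p = app_metric g (nabla V sharp) Z p + app_form \<omega> V p * app_form \<omega> Z p
    + app_form \<omega> sharp p * app_metric g V Z p" if "vf V" for V
    unfolding app_metric_L[OF that Z] by simp
  have l: "L V p f = nabla V sharp p f + app_form \<omega> V p * sharp p f + app_form \<omega> sharp p * V p f" for V
    by (simp add: L_def scale_field_def scaleR_fun_def)
  have sym: "app_metric g Y X p = app_metric g X Y p"
    using app_metric_sym[OF X Y] by simp
  show "curvature A dual X Y Z p f = (curvature A nabla X Y Z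
      + (scale_field (app_metric g (L X) Z) Y - scale_field (app_metric g (L Y) Z) X
        + scale_field (app_metric g Y Z) (L X) - scale_field (app_metric g X Z) (L Y))) p f"
    by (simp add: curvature_def scale_field_def scaleR_fun_def d[of X "dual Y Z"] d[of Y "dual X Z"]
        d[of ?B Z] d[of Y Z] d[of X Z] nd[OF X Y] nd[OF Y X] fd[OF X] fd[OF Y] md[OF X Y] md[OF Y X]
        dm[OF X Y] dm[OF Y X] df[OF X] df[OF Y] cl br mL[OF X] mL[OF Y] l[of X] l[of Y] sym)
      (simp add: algebra_simps)
qed

lemma vf_curvature: "vf X \<Longrightarrow> vf Y \<Longrightarrow> vf Z \<Longrightarrow> vf (curvature A nabla X Y Z)"
  unfolding curvature_def by (simp add: bracket_eq vf_intros)

lemma vf_curvature_dual: "vf X \<Longrightarrow> vf Y \<Longrightarrow> vf Z \<Longrightarrow> vf (curvature A dual X Y Z)"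
  unfolding curvature_def by (simp add: bracket_eq vf_intros)

lemma curvature_dual_connection:
  "vf X \<Longrightarrow> vf Y \<Longrightarrow> vf Z \<Longrightarrow>
    curvature A (dual_connection A g nabla) X Y Z = curvature A dual X Y Z"
  unfolding curvature_def by (simp add: bracket_eq vf_intros dual_connection_eq)

section \<open>Ricci tensors and the pointwise trace argument\<close>

definition basis_at :: "'m \<Rightarrow> 'm tangent_vector set"
  where "basis_at p = (SOME B. independent B \<and> span B = tangent_space A p)"

lemma basis_at:
  shows independent_basis_at: "independent (basis_at p)"
    and span_basis_at: "span (basis_at p) = tangent_space A p"
    and finite_basis_at: "finite (basis_at p)"
proof -
  have "\<exists>B. independent B \<and> span B = tangent_space A p"
    using basis_exists[of "tangent_space A p"] span_subspace[OF _ _ tangent_space_subspace] by metis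
  from someI_ex[OF this] show i: "independent (basis_at p)" and s: "span (basis_at p) = tangent_space A p"
    by (auto simp: basis_at_def)
  obtain S where "finite S" "span S = tangent_space A p"
    using finite_spanning_set by blast
  then show "finite (basis_at p)"
    using independent_span_bound[of S "basis_at p"] i s span_superset[of "basis_at p"] by auto
qed

text \<open>Repeats the choice term of \<open>value_at\<close>, just as \<open>basis_at\<close>
  repeats that of \<open>trace_on\<close>. Both Ricci tensors thus become sums over one basis with
  the same extensions, and \<open>Ricci_eq\<close> is mere unfolding.\<close>

definition extension :: "'m \<Rightarrow> 'm tangent_vector \<Rightarrow> 'm field"
  where "extension p v = (SOME X. vector_field A X \<and> X p = v)"

lemma extension:
  assumes "v \<in> tangent_space A p"
  shows "vf (extension p v)" "extension p v p = v"
  using someI_ex[OF vector_field_extension[OF assms]] by (auto simp: extension_def)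

lemma Ricci_eq:
  "Ricci A D Y Z p =
    (\<Sum>b\<in>basis_at p. representation (basis_at p) (curvature A D (extension p b) Y Z p) b)"
  by (simp add: Ricci_def trace_on_def value_at_def basis_at_def extension_def Let_def)

text \<open>Taken with the basis and the extensions of \<open>Ricci_eq\<close>, so that it appears
  verbatim in the difference of the Ricci tensors. The argument relies on its being independent of Y
  and Z.\<close>

definition trace_L :: "'m \<Rightarrow> real"
  where "trace_L p = (\<Sum>b\<in>basis_at p. representation (basis_at p) (L (extension p b) p) b)"

lemma Ricci_dual_connection:
  assumes Y: "vf Y" and Z: "vf Z"
  shows "Ricci A (dual_connection A g nabla) Y Z p = Ricci A nabla Y Z p
    + trace_L p * app_metric g Y Z p - card (basis_at p) * app_metric g (L Y) Z p"
proof -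
  let ?B = "basis_at p" and ?E = "extension p"
  let ?r = "representation ?B"
  have bT: "b \<in> tangent_space A p" if "b \<in> ?B" for b
    using that span_basis_at span_base by blast
  note ext = extension[OF bT]
  have sp: "X p \<in> span ?B" if "vf X" for X
    unfolding span_basis_at by (rule vector_field_tangent[OF that])
  note r_simps = real_vector.representation_add[OF independent_basis_at]
    real_vector.representation_diff[OF independent_basis_at]
    real_vector.representation_scale[OF independent_basis_at]
  have reconstruct: "(\<Sum>b\<in>?B. ?r (X p) b *\<^sub>R b) = X p" if "vf X" for X
    by (rule real_vector.sum_representation_eq[OF independent_basis_at sp[OF that] finite_basis_at subset_refl])
  \<comment> \<open>The trace of a rank-one map: it sends \<open>b\<close> to
    \<open>g p b (W p)\<close> times \<open>X p\<close>.\<close>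
  have contract: "(\<Sum>b\<in>?B. ?r (X p) b * g p b (W p)) = app_metric g X W p" if "vf X" "vf W" for X W
    using metric_sum_left[where u = "\<lambda>b. b" and I = ?B and c = "?r (X p)", OF bT vector_field_tangent[OF that(2)]]
    by (simp add: reconstruct[OF that(1)] app_metric_def)
  have summand: "?r (curvature A (dual_connection A g nabla) (?E b) Y Z p) b =
      ?r (curvature A nabla (?E b) Y Z p) b
      + (?r (Y p) b * g p b (L Z p) - app_metric g (L Y) Z p
        + app_metric g Y Z p * ?r (L (?E b) p) b - ?r (L Y p) b * g p b (Z p))" if b: "b \<in> ?B" for b
  proof -
    \<comment> \<open>Symmetry moves \<open>L\<close> from the chosen extension of \<open>b\<close>
      to Z; the summand is then visibly linear in \<open>b\<close> and \<open>contract\<close>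
      applies.\<close>
    have sym: "app_metric g (L (?E b)) Z p = g p b (L Z p)"
      using L_symmetric[OF ext(1)[OF b] Z] app_metric_sym[OF vf_L[OF Z] ext(1)[OF b]] ext(2)[OF b]
      by (simp add: app_metric_def)
    have eq: "curvature A (dual_connection A g nabla) (?E b) Y Z p = curvature A nabla (?E b) Y Z p
      + (g p b (L Z p) *\<^sub>R Y p - app_metric g (L Y) Z p *\<^sub>R b
        + app_metric g Y Z p *\<^sub>R L (?E b) p - g p b (Z p) *\<^sub>R L Y p)"
      unfolding curvature_dual_connection[OF ext(1)[OF b] Y Z] curvature_dual[OF ext(1)[OF b] Y Z]
      using sym ext(2)[OF b] by (simp add: scale_field_def app_metric_def)
    \<comment> \<open>Summed over the basis, this produces the factor \<open>card ?B\<close> in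
      front of g(LY,Z).\<close>
    have "?r b b = 1"
      using real_vector.representation_basis[OF independent_basis_at b] by simp
    then show ?thesis
      unfolding eq using b
      by (simp add: r_simps span_add span_diff span_scale span_base sp vf_curvature ext(1) Y Z vf_L)
  qed
  have "Ricci A (dual_connection A g nabla) Y Z p = Ricci A nabla Y Z p
      + ((\<Sum>b\<in>?B. ?r (Y p) b * g p b (L Z p)) - card ?B * app_metric g (L Y) Z p
        + app_metric g Y Z p * trace_L p - (\<Sum>b\<in>?B. ?r (L Y p) b * g p b (Z p)))"
    unfolding Ricci_eq trace_L_def
    by (simp add: summand sum.distrib sum_subtractf sum_distrib_left cong: sum.cong)
  then show ?thesis
    using contract[OF Y vf_L[OF Z]] contract[OF vf_L[OF Y] Z] L_symmetric[OF Y Z]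
      app_metric_sym[OF Y vf_L[OF Z]]
    by simp
qed

text \<open>Equal Ricci tensors give n g(LY,Z) = tr(L) g(Y,Z) at each point for all Y and Z, and
  nondegeneracy of the metric turns this into an equation for L itself.\<close>

lemma curvature_eq_if_Ricci_eq:
  assumes Ric: "\<And>Y Z. vf Y \<Longrightarrow> vf Z \<Longrightarrow> Ricci A nabla Y Z = Ricci A (dual_connection A g nabla) Y Z"
    and X: "vf X" and Y: "vf Y" and Z: "vf Z"
  shows "curvature A (dual_connection A g nabla) X Y Z = curvature A nabla X Y Z"
proof
  fix p
  let ?n = "card (basis_at p)"
  show "curvature A (dual_connection A g nabla) X Y Z p = curvature A nabla X Y Z p"
  proof (cases "?n = 0")
    \<comment> \<open>The factor below is a quotient by \<open>?n\<close>. If \<open>?n\<close> is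
      0, the tangent space is trivial and both curvature values are its only element.\<close>
    case True
    then have "tangent_space A p = {0}"
      using span_basis_at[of p] finite_basis_at[of p] by simp
    then show ?thesis
      using vector_field_tangent[OF vf_curvature[OF X Y Z], of p]
        vector_field_tangent[OF vf_curvature_dual[OF X Y Z], of p]
      by (simp add: curvature_dual_connection[OF X Y Z])
  next
    case False
    define c where "c = trace_L p / ?n"
    have L_eq: "L W p = c *\<^sub>R W p" if W: "vf W" for W
    proof (rule metric_eqI)
      show "L W p \<in> tangent_space A p" "c *\<^sub>R W p \<in> tangent_space A p"
        using vector_field_tangent vf_L W subspace_scale[OF tangent_space_subspace] by blast+
      \<comment> \<open>The hypothesis is about fields, so an arbitrary tangent vector is first
        extended to one.\<close>
      fix v assume v: "v \<in> tangent_space A p"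
      have "?n * app_metric g (L W) (extension p v) p = trace_L p * app_metric g W (extension p v) p"
        using Ricci_dual_connection[OF W extension(1)[OF v], of p] Ric[OF W extension(1)[OF v]] by simp
      then show "g p (L W p) v = g p (c *\<^sub>R W p) v"
        using False metric_scale_left[OF vector_field_tangent[OF W] v]
        by (simp add: app_metric_def extension(2)[OF v] c_def field_simps)
    qed
    have mL: "app_metric g (L W) Z p = c * app_metric g W Z p" if "vf W" for W
      using metric_scale_left[OF vector_field_tangent[OF that] vector_field_tangent[OF Z]]
      by (simp add: app_metric_def L_eq[OF that])
    show ?thesis
      unfolding curvature_dual_connection[OF X Y Z] curvature_dual[OF X Y Z]
      by (simp add: scale_field_def mL X Y L_eq mult.commute)
  qed
qed

end

theorem theorem4p1:
  fixes A :: "('m::{t2_space,second_countable_topology}, 'n::finite) chart set"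
    and g :: "'m form2" and nabla :: "'m connection" and \<omega> :: "'m form1"
  assumes "statistical_manifold A g nabla"
    and "one_form A \<omega>" and "closed_form A \<omega>"
    and "\<And>X Y Z. vector_field A X \<Longrightarrow> vector_field A Y \<Longrightarrow> vector_field A Z \<Longrightarrow>
      nabla_metric g nabla Y Z X =
        app_form \<omega> X * app_metric g Y Z + app_form \<omega> Y * app_metric g Z X
          + app_form \<omega> Z * app_metric g X Y"
  shows "conjugate_symmetric A g nabla \<longleftrightarrow> conjugate_Ricci_symmetric A g nabla"
proof -
  interpret recurrent_statistical_manifold A g nabla \<omega>
    using assms by unfold_locales (auto simp: statistical_manifold_def)
  show ?thesis
  proof
    assume sym: "conjugate_symmetric A g nabla"
    show "conjugate_Ricci_symmetric A g nabla"
      unfolding conjugate_Ricci_symmetric_def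
    proof (intro allI impI ext)
      fix Y Z p assume "vector_field A Y" "vector_field A Z"
      \<comment> \<open>Basis vectors are tangent vectors, so their chosen extensions are fields to
        which the equality of curvatures applies.\<close>
      moreover have "vector_field A (extension p b)" if "b \<in> basis_at p" for b
        using that span_base[of b "basis_at p"] extension(1) by (simp add: span_basis_at)
      ultimately show "Ricci A nabla Y Z p = Ricci A (dual_connection A g nabla) Y Z p"
        using sym unfolding Ricci_eq conjugate_symmetric_def by (intro sum.cong) simp_all
    qed
  next
    assume "conjugate_Ricci_symmetric A g nabla"
    then show "conjugate_symmetric A g nabla"
      using curvature_eq_if_Ricci_eq
      unfolding conjugate_Ricci_symmetric_def conjugate_symmetric_def by metis
  qed
qed

end
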